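(* Let $a\in[0,1]$, let $\mathcal A$ be a monotone graph property, let $m=n^{\alpha}$ with a constant $\alpha>4$, and let $$\Omega\!\left(\frac{1}{n\sqrt[3]{m}}\right)=p=O\!\left(\sqrt{\frac{\ln n}{m}}\right).$$ Put $$p_-=1-\exp(-mp^2(1-p)^{n-2}),\qquad p_+=1-\exp(-mp^2(1-p)^{n-2})+10\sqrt[3]{mp^3}.$$ If $\Pr\{G(n,p_-)\in\mathcal A\}\to a$ and $\Pr\{G(n,p_+)\in\mathcal A\}\to a$, then $\Pr\{\mathcal G(n,m,p)\in\mathcal A\}\to a$.
   Context: $G(n,p)$ denotes the binomial random graph on an $n$-element vertex set, each edge present independently with probability $p$. The random intersection graph $\mathcal G(n,m,p)$: vertex set $\mathcal V$, $|\mathcal V|=n$, object set $\mathcal W$, $|\mathcal W|=m$; each vertex $v$ receives $W(v)\subseteq\mathcal W$ with the events $w\in W(v)$ independent of probability $p$ for all $(v,w)$; $v_1\ne v_2$ are adjacent iff $W(v_1)\cap W(v_2)\ne\emptyset$. A graph property (isomorphism-closed family of graphs on the vertex set) is monotone if it is closed under adding edges or closed under deleting edges. Limits are as $n\to\infty$. *)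

theory Defs
  imports Complex_Main "HOL-Library.Landau_Symbols" "HOL-Library.FuncSet"
begin

text \<open>Simple graphs on the vertex set {0..<n}, represented by their edge sets
  (sets of 2-element subsets of {0..<n}).\<close>

definition all_edges :: "nat \<Rightarrow> nat set set" where
  "all_edges n = {e. \<exists>u v. u < n \<and> v < n \<and> u \<noteq> v \<and> e = {u, v}}"

definition graphs :: "nat \<Rightarrow> nat set set set" where
  "graphs n = Pow (all_edges n)"

definition graph_property :: "nat \<Rightarrow> nat set set set \<Rightarrow> bool" where
  "graph_property n P \<longleftrightarrow> P \<subseteq> graphs n \<and>
     (\<forall>\<pi> E. bij_betw \<pi> {..<n} {..<n} \<longrightarrow> E \<in> P \<longrightarrow> (\<lambda>e. \<pi> ` e) ` E \<in> P)"

definition increasing_prop :: "nat \<Rightarrow> nat set set set \<Rightarrow> bool" where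
  "increasing_prop n P \<longleftrightarrow> (\<forall>E F. E \<in> P \<longrightarrow> E \<subseteq> F \<longrightarrow> F \<subseteq> all_edges n \<longrightarrow> F \<in> P)"

definition decreasing_prop :: "nat \<Rightarrow> nat set set set \<Rightarrow> bool" where
  "decreasing_prop n P \<longleftrightarrow> (\<forall>E F. E \<in> P \<longrightarrow> F \<subseteq> E \<longrightarrow> F \<in> P)"

definition monotone_graph_property :: "(nat \<Rightarrow> nat set set set) \<Rightarrow> bool" where
  "monotone_graph_property A \<longleftrightarrow> (\<forall>n. graph_property n (A n)) \<and>
     ((\<forall>n. increasing_prop n (A n)) \<or> (\<forall>n. decreasing_prop n (A n)))"

definition prob_Gnp :: "nat \<Rightarrow> real \<Rightarrow> nat set set set \<Rightarrow> real" where
  "prob_Gnp n p P = (\<Sum>E\<in>graphs n. if E \<in> P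
       then p ^ card E * (1 - p) ^ (card (all_edges n) - card E) else 0)"

definition inter_graph :: "nat \<Rightarrow> (nat \<Rightarrow> nat set) \<Rightarrow> nat set set" where
  "inter_graph n W = {e. \<exists>u v. u < n \<and> v < n \<and> u \<noteq> v \<and> e = {u, v} \<and> W u \<inter> W v \<noteq> {}}"

text \<open>Pr{G(n,m,p) \<in> P}: objects {0..<m}; each event w \<in> W(v) independent with probability p.\<close>
definition prob_RIG :: "nat \<Rightarrow> nat \<Rightarrow> real \<Rightarrow> nat set set set \<Rightarrow> real" where
  "prob_RIG n m p P = (\<Sum>W\<in>PiE {..<n} (\<lambda>_. Pow {..<m}). if inter_graph n W \<in> P
       then (\<Prod>v<n. p ^ card (W v) * (1 - p) ^ (m - card (W v))) else 0)"

end

theory Submission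
  imports Defs "HOL-Probability.Probability" "HOL-Real_Asymp.Real_Asymp"
begin

text \<open>The total variation distance between the random intersection graph and $G(n,p_-)$ tends to $0$,
  so the two have the same limit for every family of graphs. Objects chosen by at least four vertices
  are absent up to probability $m n^4 p^4$. Up to total variation $m s^2$, where $s$ is the probability
  that a single object is chosen by two or three vertices, the objects chosen by a given pair or triple
  may be replaced by independent Poisson numbers of them. The graph becomes the union of $G(n,p_-)$ and
  an independent random family of triangles. Let $h$, $h'$ be two independent copies of the edge set
  of these triangles, truncated to a bounded number of triangles. The likelihood ratio of the union
  with respect to $G(n,p_-)$ has second moment $E\,p_-^{-|h \cap h'|}$, and this tends to $1$. All
  error terms are controlled by $\tau = n^2 p (1 + m p^2)$, which tends to $0$ because $\alpha > 4$.\<close>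

section \<open>Expectations and total variation for finitely supported distributions\<close>

abbreviation expect :: "'a pmf \<Rightarrow> ('a \<Rightarrow> real) \<Rightarrow> real" where
  "expect \<equiv> measure_pmf.expectation"

lemma expect_bind:
  assumes "finite (set_pmf P)" "\<And>x. x \<in> set_pmf P \<Longrightarrow> finite (set_pmf (Q x))"
  shows "expect (bind_pmf P Q) f = expect P (\<lambda>x. expect (Q x) f)"
proof -
  have "expect (bind_pmf P Q) f = (\<Sum>x\<in>set_pmf P. pmf P x *\<^sub>R expect (Q x) f)"
    using assms by (intro pmf_expectation_bind) auto
  also have "\<dots> = expect P (\<lambda>x. expect (Q x) f)"
    using assms by (subst integral_measure_pmf_real[where A = "set_pmf P"]) (auto simp: mult.commute)
  finally show ?thesis .
qed

lemma expect_mono: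
  fixes f g :: "'a \<Rightarrow> real"
  assumes "finite (set_pmf P)" "\<And>x. x \<in> set_pmf P \<Longrightarrow> f x \<le> g x"
  shows "expect P f \<le> expect P g"
  using assms by (intro integral_mono_AE integrable_measure_pmf_finite) (auto simp: AE_measure_pmf_iff)

lemma expect_cong:
  fixes f g :: "'a \<Rightarrow> real"
  assumes "\<And>x. x \<in> set_pmf P \<Longrightarrow> f x = g x"
  shows "expect P f = expect P g"
  using assms by (intro integral_cong_AE) (auto simp: AE_measure_pmf_iff)

lemma expect_add:
  assumes "finite (set_pmf P)"
  shows "expect P (\<lambda>x. f x + g x) = expect P f + expect P g"
  by (intro Bochner_Integration.integral_add integrable_measure_pmf_finite assms)

lemma expect_diff:
  assumes "finite (set_pmf P)"
  shows "expect P (\<lambda>x. f x - g x) = expect P f - expect P g"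
  by (intro Bochner_Integration.integral_diff integrable_measure_pmf_finite assms)

lemma expect_sum:
  assumes "finite (set_pmf P)"
  shows "expect P (\<lambda>x. \<Sum>i\<in>I. f i x) = (\<Sum>i\<in>I. expect P (f i))"
  by (intro Bochner_Integration.integral_sum integrable_measure_pmf_finite assms)

lemma expect_swap:
  assumes "finite (set_pmf P)" "finite (set_pmf Q)"
  shows "expect P (\<lambda>x. expect Q (\<lambda>y. f x y)) = expect Q (\<lambda>y. expect P (\<lambda>x. f x y))"
proof -
  have fs: "expect R g = (\<Sum>x\<in>set_pmf R. g x * pmf R x)" if "finite (set_pmf R)"
    for R :: "'c pmf" and g
    using that by (intro integral_measure_pmf_real) auto
  show ?thesis
    unfolding fs[OF assms(1)] fs[OF assms(2)] sum_distrib_right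
    by (subst sum.swap) (simp add: algebra_simps)
qed

text \<open>Testing against all functions with values in the unit interval, and not only against events,
  makes the distance compatible with \<^const>\<open>bind_pmf\<close>.\<close>

definition tv_within :: "'a pmf \<Rightarrow> 'a pmf \<Rightarrow> real \<Rightarrow> bool" where
  "tv_within P Q d \<longleftrightarrow> (\<forall>f. (\<forall>x. 0 \<le> f x \<and> f x \<le> 1) \<longrightarrow> \<bar>expect P f - expect Q f\<bar> \<le> d)"

lemma tv_withinD:
  assumes "tv_within P Q d" "\<And>x. 0 \<le> f x" "\<And>x. f x \<le> 1"
  shows "\<bar>expect P f - expect Q f\<bar> \<le> d"
  using assms by (auto simp: tv_within_def)

text \<open>Applying the one-sided bound to \<open>1 - f\<close>, again a test function, gives the
  opposite inequality.\<close>

lemma tv_withinI: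
  assumes fin: "finite (set_pmf P)" "finite (set_pmf Q)"
    and le: "\<And>f. \<lbrakk>\<And>x. 0 \<le> f x; \<And>x. f x \<le> 1\<rbrakk> \<Longrightarrow> expect P f \<le> expect Q f + d"
  shows "tv_within P Q d"
  unfolding tv_within_def
proof (intro allI impI)
  fix f :: "'a \<Rightarrow> real" assume f: "\<forall>x. 0 \<le> f x \<and> f x \<le> 1"
  have "expect P (\<lambda>x. 1 - f x) \<le> expect Q (\<lambda>x. 1 - f x) + d"
    using f by (intro le) auto
  then have "1 - expect P f \<le> 1 - expect Q f + d"
    by (simp add: expect_diff fin)
  moreover have "expect P f \<le> expect Q f + d"
    using f by (intro le) auto
  ultimately show "\<bar>expect P f - expect Q f\<bar> \<le> d" by linarith
qed

lemma tv_within_trans: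
  assumes "tv_within P Q d" "tv_within Q R e"
  shows "tv_within P R (d + e)"
  unfolding tv_within_def
proof (intro allI impI)
  fix f :: "'a \<Rightarrow> real" assume "\<forall>x. 0 \<le> f x \<and> f x \<le> 1"
  then show "\<bar>expect P f - expect R f\<bar> \<le> d + e"
    using tv_withinD[OF assms(1), of f] tv_withinD[OF assms(2), of f] by force
qed

section \<open>Independent random subsets\<close>

text \<open>Inclusion probabilities may vary with the element, so that pairs and triples of vertices
  can carry different weights in one independent family.\<close>

definition random_subset :: "'a set \<Rightarrow> ('a \<Rightarrow> real) \<Rightarrow> 'a set pmf" where
  "random_subset X r = map_pmf (\<lambda>b. {x\<in>X. b x}) (Pi_pmf X False (\<lambda>x. bernoulli_pmf (r x)))"

lemma set_random_subset: "set_pmf (random_subset X r) \<subseteq> Pow X"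
  by (auto simp: random_subset_def)

lemma finite_random_subset [simp]: "finite X \<Longrightarrow> finite (set_pmf (random_subset X r))"
  using set_random_subset finite_subset finite_Pow_iff by metis

lemma random_subset_empty [simp]: "random_subset {} r = return_pmf {}"
  by (simp add: random_subset_def)

text \<open>Tossing the coin of \<open>x\<close> first gives the recursion that drives the
  inductions over the ground set.\<close>

lemma random_subset_insert:
  assumes "finite X" "x \<notin> X"
  shows "random_subset (insert x X) r = bernoulli_pmf (r x) \<bind>
    (\<lambda>b. map_pmf (\<lambda>Y. if b then insert x Y else Y) (random_subset X r))"
proof -
  have "{z \<in> insert x X. (f(x := b)) z} = (if b then insert x {z\<in>X. f z} else {z\<in>X. f z})" for f b
    using assms(2) by auto
  then show ?thesis
    unfolding random_subset_def Pi_pmf_insert'[OF assms]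
    by (simp only: map_bind_pmf map_return_pmf map_pmf_comp) (simp add: map_pmf_def)
qed

lemma random_subset_cong:
  assumes "finite X" "\<And>x. x \<in> X \<Longrightarrow> r x = s x"
  shows "random_subset X r = random_subset X s"
  unfolding random_subset_def
  using assms by (intro arg_cong[where f = "map_pmf _"] Pi_pmf_cong) auto

lemma random_subset_Un:
  assumes "finite A" "finite B" "A \<inter> B = {}"
  shows "random_subset (A \<union> B) r =
    random_subset A r \<bind> (\<lambda>Y. map_pmf (\<lambda>Z. Y \<union> Z) (random_subset B r))"
  using assms
proof (induction A rule: finite_induct)
  case empty
  have [simp]: "(\<union>) {} = (\<lambda>Z :: 'a set. Z)" by auto
  show ?case by (simp add: bind_return_pmf)
next
  case (insert x A)
  have "random_subset (insert x A \<union> B) r = bernoulli_pmf (r x) \<bind> (\<lambda>b. random_subset A r \<bind>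
      (\<lambda>Y. map_pmf (\<lambda>Z. if b then insert x (Y \<union> Z) else Y \<union> Z) (random_subset B r)))"
    using insert by (simp add: random_subset_insert map_bind_pmf map_pmf_comp)
  also have "\<dots> = random_subset (insert x A) r \<bind> (\<lambda>Y. map_pmf (\<lambda>Z. Y \<union> Z) (random_subset B r))"
    using insert
    by (auto simp: random_subset_insert bind_assoc_pmf bind_map_pmf intro!: bind_pmf_cong map_pmf_cong)
  finally show ?case .
qed

lemma bernoulli_pmf_or:
  assumes "0 \<le> p" "p \<le> 1" "0 \<le> q" "q \<le> 1"
  shows "bernoulli_pmf p \<bind> (\<lambda>b. map_pmf (\<lambda>c. b \<or> c) (bernoulli_pmf q))
    = bernoulli_pmf (1 - (1 - p) * (1 - q))"
proof (rule pmf_eqI)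
  fix i
  have 1: "0 \<le> 1 - (1 - p) * (1 - q)" "1 - (1 - p) * (1 - q) \<le> 1"
    using assms by (auto simp: mult_le_one)
  have [simp]: "(\<or>) True = (\<lambda>_. True)" "(\<or>) False = (\<lambda>c. c)" by auto
  then show "pmf (bernoulli_pmf p \<bind> (\<lambda>b. map_pmf (\<lambda>c. b \<or> c) (bernoulli_pmf q))) i
      = pmf (bernoulli_pmf (1 - (1 - p) * (1 - q))) i"
    using assms 1 by (cases i) (simp_all add: pmf_bind map_pmf_const algebra_simps)
qed

text \<open>An element is missed by the union only if both independent subsets miss it. In the
  induction the two coins of \<open>x\<close> are brought together by commuting the second one past
  the rest of the first subset.\<close>

lemma random_subset_union:
  assumes "finite X" "\<And>x. x \<in> X \<Longrightarrow> 0 \<le> r x \<and> r x \<le> 1" "\<And>x. x \<in> X \<Longrightarrow> 0 \<le> s x \<and> s x \<le> 1"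
  shows "random_subset X r \<bind> (\<lambda>Y. map_pmf (\<lambda>Z. Y \<union> Z) (random_subset X s))
    = random_subset X (\<lambda>x. 1 - (1 - r x) * (1 - s x))"
  using assms
proof (induction X rule: finite_induct)
  case empty
  then show ?case by (simp add: bind_return_pmf)
next
  case (insert x X)
  let ?ins = "\<lambda>b Y. if b then insert x Y else Y"
  have "random_subset (insert x X) r \<bind> (\<lambda>Y. map_pmf (\<lambda>Z. Y \<union> Z) (random_subset (insert x X) s))
    = bernoulli_pmf (r x) \<bind> (\<lambda>b. random_subset X r \<bind> (\<lambda>Y. bernoulli_pmf (s x) \<bind>
       (\<lambda>c. map_pmf (\<lambda>Z. ?ins b Y \<union> ?ins c Z) (random_subset X s))))"
    using insert by (simp add: random_subset_insert map_bind_pmf map_pmf_comp bind_assoc_pmf bind_map_pmf)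
  also have "\<dots> = bernoulli_pmf (r x) \<bind> (\<lambda>b. bernoulli_pmf (s x) \<bind> (\<lambda>c. random_subset X r \<bind>
       (\<lambda>Y. map_pmf (\<lambda>Z. ?ins b Y \<union> ?ins c Z) (random_subset X s))))"
    by (rule bind_pmf_cong[OF refl], rule bind_commute_pmf)
  also have "\<dots> = bernoulli_pmf (r x) \<bind> (\<lambda>b. bernoulli_pmf (s x) \<bind> (\<lambda>c. random_subset X r \<bind>
       (\<lambda>Y. map_pmf (\<lambda>Z. ?ins (b \<or> c) (Y \<union> Z)) (random_subset X s))))"
    by (intro bind_pmf_cong map_pmf_cong refl) auto
  also have "\<dots> = (bernoulli_pmf (r x) \<bind> (\<lambda>b. map_pmf (\<lambda>c. b \<or> c) (bernoulli_pmf (s x)))) \<bind>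
      (\<lambda>d. map_pmf (?ins d) (random_subset X r \<bind> (\<lambda>Y. map_pmf (\<lambda>Z. Y \<union> Z) (random_subset X s))))"
    by (simp add: bind_assoc_pmf bind_map_pmf map_bind_pmf map_pmf_comp)
  also have "\<dots> = random_subset (insert x X) (\<lambda>x. 1 - (1 - r x) * (1 - s x))"
    using insert by (subst bernoulli_pmf_or) (simp_all add: random_subset_insert)
  finally show ?case .
qed

section \<open>Point probabilities, product functionals and change of measure\<close>

lemma pmf_random_subset:
  assumes "finite X" "\<And>x. x \<in> X \<Longrightarrow> 0 \<le> r x \<and> r x \<le> 1" "E \<subseteq> X"
  shows "pmf (random_subset X r) E = (\<Prod>x\<in>X. if x \<in> E then r x else 1 - r x)"
proof -
  have "(\<lambda>b. {x\<in>X. b x}) -` {E} = Pi X (\<lambda>x. {x \<in> E})"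
    using assms(3) by auto
  then have "pmf (random_subset X r) E = (\<Prod>x\<in>X. measure_pmf.prob (bernoulli_pmf (r x)) {x \<in> E})"
    by (simp add: random_subset_def pmf_map measure_Pi_pmf_Pi assms(1))
  also have "\<dots> = (\<Prod>x\<in>X. if x \<in> E then r x else 1 - r x)"
    using assms(2) by (intro prod.cong) (auto simp: measure_pmf_single)
  finally show ?thesis .
qed

lemma pmf_random_subset_const:
  assumes "finite X" "0 \<le> q" "q \<le> 1" "E \<subseteq> X"
  shows "pmf (random_subset X (\<lambda>_. q)) E = q ^ card E * (1 - q) ^ (card X - card E)"
proof -
  have "(\<Prod>x\<in>X. if x \<in> E then q else 1 - q) = q ^ card (X \<inter> E) * (1 - q) ^ card (X - E)"
    using assms(1) by (subst prod.If_cases) (auto simp: Diff_eq)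
  with assms show ?thesis
    by (subst pmf_random_subset) (auto simp: Int_absorb1 card_Diff_subset finite_subset)
qed

text \<open>By independence each \<open>x\<close> contributes a factor of its own, which is
  \<open>c x\<close> when \<open>x\<close> is chosen and 1 otherwise.\<close>

lemma expect_random_subset_prod:
  assumes "finite X" "\<And>x. x \<in> X \<Longrightarrow> 0 \<le> r x \<and> r x \<le> 1"
  shows "expect (random_subset X r) (\<lambda>Y. \<Prod>x\<in>Y. c x) = (\<Prod>x\<in>X. 1 + r x * (c x - 1))"
  using assms
proof (induction X rule: finite_induct)
  case (insert x X)
  have "expect (random_subset X r) (\<lambda>Y. \<Prod>z\<in>(if b then insert x Y else Y). c z)
      = (if b then c x else 1) * expect (random_subset X r) (\<lambda>Y. \<Prod>z\<in>Y. c z)" for b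
  proof -
    have "(\<Prod>z\<in>(if b then insert x Y else Y). c z) = (if b then c x else 1) * (\<Prod>z\<in>Y. c z)"
      if "Y \<in> set_pmf (random_subset X r)" for Y
    proof -
      have "Y \<subseteq> X" using that set_random_subset[of X r] by blast
      then have "finite Y" "x \<notin> Y" using insert(1,2) finite_subset by auto
      then show ?thesis by simp
    qed
    then show ?thesis
      by (subst expect_cong[where g = "\<lambda>Y. (if b then c x else 1) * (\<Prod>z\<in>Y. c z)"]) auto
  qed
  then have "expect (random_subset (insert x X) r) (\<lambda>Y. \<Prod>z\<in>Y. c z)
    = expect (bernoulli_pmf (r x)) (\<lambda>b. (if b then c x else 1) * expect (random_subset X r) (\<lambda>Y. \<Prod>z\<in>Y. c z))"
    using insert by (simp add: random_subset_insert expect_bind)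
  also have "\<dots> = (1 + r x * (c x - 1)) * expect (random_subset X r) (\<lambda>Y. \<Prod>z\<in>Y. c z)"
    using insert by (simp add: algebra_simps)
  finally show ?case using insert by simp
qed simp

text \<open>Forcing \<open>h\<close> into the subset amounts to conditioning on
  \<open>h \<subseteq> Y\<close>, an event of probability \<open>q ^ card h\<close>. Hence the law
  of \<open>Y \<union> h\<close> has density \<open>(1 / q) ^ card h\<close> on the supersets of
  \<open>h\<close>.\<close>

lemma expect_random_subset_superset:
  assumes "finite X" "h \<subseteq> X" "0 < q" "q \<le> 1"
  shows "expect (random_subset X (\<lambda>_. q)) (\<lambda>Y. f (Y \<union> h))
    = expect (random_subset X (\<lambda>_. q)) (\<lambda>Y. (if h \<subseteq> Y then (1 / q) ^ card h else 0) * f Y)"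
proof -
  \<comment> \<open>The coins in \<open>h\<close> and those outside it are independent. With the
    outer part \<open>Z\<close> fixed, the only inner set with nonzero density is
    \<open>S = h\<close>.\<close>
  let ?P = "random_subset h (\<lambda>_. q)" and ?Q = "random_subset (X - h) (\<lambda>_. q)"
  have fin: "finite h" using assms finite_subset by blast
  have X: "X = (X - h) \<union> h" using assms by auto
  have split: "expect (random_subset X (\<lambda>_. q)) g = expect ?Q (\<lambda>Z. expect ?P (\<lambda>S. g (Z \<union> S)))" for g
    using assms fin by (subst X, subst random_subset_Un) (auto simp: expect_bind)
  have "expect ?P (\<lambda>S. f (Z \<union> S \<union> h)) = expect ?P (\<lambda>S. (if h \<subseteq> Z \<union> S then (1 / q) ^ card h else 0) * f (Z \<union> S))"
    if Z: "Z \<in> set_pmf ?Q" for Z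
  proof -
    have Zh: "Z \<inter> h = {}" using Z set_random_subset by fastforce
    have S: "S \<subseteq> h" if "S \<in> set_pmf ?P" for S using that set_random_subset by fastforce
    have "expect ?P (\<lambda>S. f (Z \<union> S \<union> h)) = expect ?P (\<lambda>S. f (Z \<union> h))"
      using S by (intro expect_cong arg_cong[where f = f]) auto
    also have "\<dots> = (\<Sum>S\<in>{h}. ((1 / q) ^ card h * f (Z \<union> h)) * pmf ?P S)"
      using assms fin by (simp add: pmf_random_subset_const power_one_over)
    also have "\<dots> = expect ?P (\<lambda>S. if S = h then (1 / q) ^ card h * f (Z \<union> h) else 0)"
      by (subst integral_measure_pmf_real[where A = "{h}"]) (auto split: if_splits)
    also have "\<dots> = expect ?P (\<lambda>S. (if h \<subseteq> Z \<union> S then (1 / q) ^ card h else 0) * f (Z \<union> S))"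
    proof (rule expect_cong)
      fix S assume "S \<in> set_pmf ?P"
      then have "h \<subseteq> Z \<union> S \<longleftrightarrow> S = h" using S[of S] Zh by auto
      then show "(if S = h then (1 / q) ^ card h * f (Z \<union> h) else 0)
        = (if h \<subseteq> Z \<union> S then (1 / q) ^ card h else 0) * f (Z \<union> S)" by auto
    qed
    finally show ?thesis .
  qed
  then show ?thesis unfolding split by (rule expect_cong)
qed

text \<open>The case \<open>f = 1\<close> of the change of measure: the density has total mass
  1.\<close>

lemma prob_superset_random_subset:
  assumes "finite X" "h \<subseteq> X" "0 < q" "q \<le> 1"
  shows "expect (random_subset X (\<lambda>_. q)) (\<lambda>Y. of_bool (h \<subseteq> Y)) = q ^ card h"
proof -
  have "1 = expect (random_subset X (\<lambda>_. q)) (\<lambda>Y. (1 / q) ^ card h * of_bool (h \<subseteq> Y))"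
    using expect_random_subset_superset[OF assms, of "\<lambda>_. 1"]
    by (subst (asm) expect_cong[where g = "\<lambda>Y. (1 / q) ^ card h * of_bool (h \<subseteq> Y)"]) auto
  then show ?thesis using assms by (simp add: field_simps)
qed

section \<open>Total variation under maps and mixtures\<close>

lemma expect_bounds:
  assumes "finite (set_pmf P)" "\<And>x. 0 \<le> f x" "\<And>x. f x \<le> 1"
  shows "0 \<le> expect P f" "expect P f \<le> 1"
  using expect_mono[OF assms(1), of "\<lambda>_. 0" f] expect_mono[OF assms(1), of f "\<lambda>_. 1"] assms(2,3)
  by auto

lemma tv_within_map:
  "tv_within P Q d \<Longrightarrow> tv_within (map_pmf g P) (map_pmf g Q) d"
  by (simp add: tv_within_def)

text \<open>The kernels are exchanged first, at cost \<open>e\<close> for each \<open>x\<close>. The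
  map from \<open>x\<close> to \<open>expect (Q' x) f\<close> is itself a test function, so
  exchanging the first stage costs \<open>d\<close>.\<close>

lemma tv_within_bind:
  fixes P P' :: "'a pmf" and Q Q' :: "'a \<Rightarrow> 'b pmf"
  assumes fin: "finite (set_pmf P)" "finite (set_pmf P')"
    "\<And>x. finite (set_pmf (Q x))" "\<And>x. finite (set_pmf (Q' x))"
    and P: "tv_within P P' d" and Q: "\<And>x. tv_within (Q x) (Q' x) e"
  shows "tv_within (P \<bind> Q) (P' \<bind> Q') (d + e)"
proof (rule tv_withinI)
  show "finite (set_pmf (P \<bind> Q))" "finite (set_pmf (P' \<bind> Q'))"
    using fin by auto
next
  fix f :: "'b \<Rightarrow> real" assume f: "\<And>x. 0 \<le> f x" "\<And>x. f x \<le> 1"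
  have "\<bar>expect (Q x) f - expect (Q' x) f\<bar> \<le> e" for x
    by (rule tv_withinD[OF Q]) (rule f)+
  then have Q_le: "expect (Q x) f \<le> expect (Q' x) f + e" for x
    by (smt (verit, best))
  have "\<bar>expect P (\<lambda>x. expect (Q' x) f) - expect P' (\<lambda>x. expect (Q' x) f)\<bar> \<le> d"
    by (rule tv_withinD[OF P]) (rule expect_bounds[OF fin(4) f])+
  moreover have "expect P (\<lambda>x. expect (Q x) f) \<le> expect P (\<lambda>x. expect (Q' x) f + e)"
    by (rule expect_mono[OF fin(1) Q_le])
  moreover have "expect P (\<lambda>x. expect (Q' x) f + e) = expect P (\<lambda>x. expect (Q' x) f) + e"
    by (subst expect_add[OF fin(1)]) simp
  moreover have "expect (P \<bind> Q) f = expect P (\<lambda>x. expect (Q x) f)"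
    "expect (P' \<bind> Q') f = expect P' (\<lambda>x. expect (Q' x) f)"
    by (rule expect_bind; use fin in blast)+
  ultimately show "expect (P \<bind> Q) f \<le> expect (P' \<bind> Q') f + (d + e)"
    by linarith
qed

section \<open>Unions of independent copies\<close>

text \<open>Each object contributes one independent clique, and the intersection graph is the union
  of these contributions.\<close>

primrec union_pow :: "'a set pmf \<Rightarrow> nat \<Rightarrow> 'a set pmf" where
  "union_pow P 0 = return_pmf {}"
| "union_pow P (Suc k) = P \<bind> (\<lambda>Y. map_pmf (\<lambda>Z. Y \<union> Z) (union_pow P k))"

lemma finite_union_pow [simp]: "finite (set_pmf P) \<Longrightarrow> finite (set_pmf (union_pow P k))"
  by (induction k) auto

text \<open>Exchanging the copies one at a time adds up the errors.\<close>

lemma tv_within_union_pow: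
  assumes "finite (set_pmf P)" "finite (set_pmf Q)" "tv_within P Q d"
  shows "tv_within (union_pow P k) (union_pow Q k) (real k * d)"
proof (induction k)
  case 0
  show ?case by (simp add: tv_within_def)
next
  case (Suc k)
  have "tv_within (union_pow P (Suc k)) (union_pow Q (Suc k)) (d + real k * d)"
    unfolding union_pow.simps
    using assms by (intro tv_within_bind tv_within_map Suc) auto
  then show ?case by (simp add: algebra_simps)
qed

text \<open>With \<open>J\<close> forming the edges of a family of vertex sets, this allows the
  families of all objects to be merged before any clique is drawn.\<close>

lemma union_pow_map:
  assumes "J {} = {}" "\<And>A B. J (A \<union> B) = J A \<union> J B"
  shows "union_pow (map_pmf J P) k = map_pmf J (union_pow P k)"
  by (induction k) (simp_all add: assms bind_map_pmf map_bind_pmf map_pmf_comp)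

text \<open>An element \<open>x\<close> is missed by all \<open>k\<close> copies with probability
  \<open>(1 - r x) ^ k\<close>. For \<open>r x = 1 - exp (- w)\<close> this is
  \<open>exp (- k * w)\<close>, so Poisson intensities simply add.\<close>

lemma union_pow_random_subset:
  assumes "finite X" "\<And>x. x \<in> X \<Longrightarrow> 0 \<le> r x \<and> r x \<le> 1"
  shows "union_pow (random_subset X r) k = random_subset X (\<lambda>x. 1 - (1 - r x) ^ k)"
proof (induction k)
  case 0
  have "bernoulli_pmf 0 = return_pmf False"
    by (rule pmf_eqI) (simp add: bernoulli_pmf.rep_eq indicator_def split: bool.split)
  then show ?case using assms(1) by (simp add: random_subset_def)
next
  case (Suc k)
  have "0 \<le> 1 - (1 - r x) ^ k \<and> 1 - (1 - r x) ^ k \<le> 1" if "x \<in> X" for x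
    using assms(2)[OF that] by (simp add: power_le_one)
  then have "union_pow (random_subset X r) (Suc k)
    = random_subset X (\<lambda>x. 1 - (1 - r x) * (1 - (1 - (1 - r x) ^ k)))"
    using assms unfolding union_pow.simps Suc by (intro random_subset_union)
  then show ?case by simp
qed

text \<open>Peeling off the coordinate \<open>k\<close> of the product distribution reproduces the
  recursion of \<open>union_pow\<close>.\<close>

lemma map_Pi_pmf_union:
  "map_pmf (\<lambda>V. \<Union>w<k. g (V w)) (Pi_pmf {..<k} d (\<lambda>_. P)) = union_pow (map_pmf g P) k"
proof (induction k)
  case 0
  show ?case by simp
next
  case (Suc k)
  have "(\<Union>w\<in>insert k {..<k}. g ((f(k := y)) w)) = g y \<union> (\<Union>w<k. g (f w))" for f y
    by auto
  then have "map_pmf (\<lambda>V. \<Union>w<Suc k. g (V w)) (Pi_pmf {..<Suc k} d (\<lambda>_. P))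
    = P \<bind> (\<lambda>y. map_pmf (\<lambda>Z. g y \<union> Z) (map_pmf (\<lambda>V. \<Union>w<k. g (V w)) (Pi_pmf {..<k} d (\<lambda>_. P))))"
    by (simp only: lessThan_Suc Pi_pmf_insert'[OF finite_lessThan] lessThan_iff less_irrefl
        not_False_eq_True map_bind_pmf map_return_pmf map_pmf_comp)
       (simp add: map_pmf_def)
  then show ?case by (simp add: Suc bind_map_pmf)
qed

section \<open>The graph models as random sets of edges\<close>

text \<open>The edges contributed by an object that is chosen by exactly the vertices in
  \<open>V\<close>.\<close>

definition clique :: "nat set \<Rightarrow> nat set set" where
  "clique V = {e. \<exists>u\<in>V. \<exists>v\<in>V. u \<noteq> v \<and> e = {u, v}}"

lemma finite_all_edges [simp]: "finite (all_edges n)"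
  by (rule finite_subset[of _ "Pow {..<n}"]) (auto simp: all_edges_def)

lemma prob_Gnp_eq:
  assumes "0 \<le> p" "p \<le> 1"
  shows "prob_Gnp n p A = expect (random_subset (all_edges n) (\<lambda>_. p)) (\<lambda>E. of_bool (E \<in> A))"
proof -
  have "expect (random_subset (all_edges n) (\<lambda>_. p)) (\<lambda>E. of_bool (E \<in> A))
    = (\<Sum>E\<in>Pow (all_edges n). of_bool (E \<in> A) * pmf (random_subset (all_edges n) (\<lambda>_. p)) E)"
    using set_random_subset by (intro integral_measure_pmf_real) auto
  also have "\<dots> = prob_Gnp n p A"
    unfolding prob_Gnp_def graphs_def
    using assms by (intro sum.cong) (auto simp: pmf_random_subset_const)
  finally show ?thesis by simp
qed

lemma inter_graph_eq_Union_clique: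
  assumes "\<And>v. v < n \<Longrightarrow> W v \<subseteq> {..<m}"
  shows "inter_graph n W = (\<Union>w<m. clique {v. v < n \<and> w \<in> W v})"
  using assms unfolding inter_graph_def clique_def by blast

text \<open>The events \<open>w \<in> W v\<close> are independent, so the incidence relation may be
  read by objects instead of by vertices. Each object then has an independent random set of choosers
  and contributes the clique on it.\<close>

lemma prob_RIG_eq:
  assumes "0 \<le> p" "p \<le> 1"
  shows "prob_RIG n m p A
    = expect (union_pow (map_pmf clique (random_subset {..<n} (\<lambda>_. p))) m) (\<lambda>E. of_bool (E \<in> A))"
proof -
  let ?\<mu> = "random_subset {..<n} (\<lambda>_. p)"
  let ?S = "PiE {..<n} (\<lambda>_. Pow {..<m})" and ?T = "PiE {..<m} (\<lambda>_. Pow {..<n})"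
  \<comment> \<open>Transposition of the incidence relation, restricted so as to be extensional.
    Exchanging the two bounds gives the inverse map.\<close>
  let ?i = "\<lambda>a b W. \<lambda>w\<in>{..<b}. {v. v < a \<and> w \<in> W v}"
  \<comment> \<open>The default \<open>undefined\<close> puts the support inside the extensional
    functions of \<open>?T\<close>.\<close>
  let ?M = "Pi_pmf {..<m} undefined (\<lambda>_. ?\<mu>)"
  have set: "set_pmf ?M \<subseteq> ?T"
    using set_random_subset[of "{..<n}" "\<lambda>_. p"]
    by (auto simp: set_Pi_pmf PiE_dflt_def PiE_iff extensional_def)
  \<comment> \<open>The weights become products over single incidences, a form that is symmetric
    under transposition.\<close>
  have eq: "(\<Prod>x<k. q ^ card (W x) * (1 - q) ^ (l - card (W x)))
      = (\<Prod>x<k. \<Prod>y<l. if y \<in> W x then q else 1 - q)"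
    if "0 \<le> q" "q \<le> 1" "W \<in> PiE {..<k} (\<lambda>_. Pow {..<l})" for W k l and q :: real
  proof (rule prod.cong[OF refl])
    fix x assume "x \<in> {..<k}"
    then have "W x \<subseteq> {..<l}" using that by auto
    then show "q ^ card (W x) * (1 - q) ^ (l - card (W x)) = (\<Prod>y<l. if y \<in> W x then q else 1 - q)"
      using that pmf_random_subset_const[of "{..<l}" q "W x"] pmf_random_subset[of "{..<l}" "\<lambda>_. q" "W x"]
      by auto
  qed
  have "prob_RIG n m p A
    = (\<Sum>W\<in>?S. of_bool (inter_graph n W \<in> A) * (\<Prod>v<n. \<Prod>w<m. if w \<in> W v then p else 1 - p))"
    unfolding prob_RIG_def using assms by (intro sum.cong) (auto simp: eq)
  also have "\<dots> = (\<Sum>V\<in>?T. of_bool ((\<Union>w<m. clique (V w)) \<in> A)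
      * (\<Prod>w<m. \<Prod>v<n. if v \<in> V w then p else 1 - p))"
  proof (rule sum.reindex_bij_witness[where i = "?i m n" and j = "?i n m"])
    fix W assume W: "W \<in> ?S"
    have "W v = ?i m n (?i n m W) v" for v
      using W by (cases "v < n") (auto simp: PiE_iff extensional_def)
    then show "?i m n (?i n m W) = W" by (intro ext) (rule sym)
    show "?i n m W \<in> ?T" by auto
    have "(\<Union>w<m. clique (?i n m W w)) = inter_graph n W"
      using W by (subst inter_graph_eq_Union_clique[where m = m]) (auto simp: PiE_iff)
    moreover have "(\<Prod>w<m. \<Prod>v<n. if v \<in> ?i n m W w then p else 1 - p)
        = (\<Prod>v<n. \<Prod>w<m. if w \<in> W v then p else 1 - p)"
      by (subst prod.swap) (auto intro!: prod.cong)
    ultimately show "of_bool ((\<Union>w<m. clique (?i n m W w)) \<in> A)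
        * (\<Prod>w<m. \<Prod>v<n. if v \<in> ?i n m W w then p else 1 - p)
      = of_bool (inter_graph n W \<in> A) * (\<Prod>v<n. \<Prod>w<m. if w \<in> W v then p else 1 - p)"
      by simp
  next
    fix V assume V: "V \<in> ?T"
    have "V w = ?i n m (?i m n V) w" for w
      using V by (cases "w < m") (auto simp: PiE_iff extensional_def)
    then show "?i n m (?i m n V) = V" by (intro ext) (rule sym)
    show "?i m n V \<in> ?S" by auto
  qed
  also have "\<dots> = (\<Sum>V\<in>?T. of_bool ((\<Union>w<m. clique (V w)) \<in> A) * pmf ?M V)"
  proof (rule sum.cong[OF refl])
    fix V assume V: "V \<in> ?T"
    then have "pmf ?M V = (\<Prod>w<m. pmf ?\<mu> (V w))"
      by (intro pmf_Pi') (auto simp: PiE_iff extensional_def)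
    also have "\<dots> = (\<Prod>w<m. \<Prod>v<n. if v \<in> V w then p else 1 - p)"
      using V assms by (intro prod.cong) (auto simp: pmf_random_subset PiE_iff)
    finally show "of_bool ((\<Union>w<m. clique (V w)) \<in> A) * (\<Prod>w<m. \<Prod>v<n. if v \<in> V w then p else 1 - p)
      = of_bool ((\<Union>w<m. clique (V w)) \<in> A) * pmf ?M V" by simp
  qed
  also have "\<dots> = expect ?M (\<lambda>V. of_bool ((\<Union>w<m. clique (V w)) \<in> A))"
    using set by (intro integral_measure_pmf_real[symmetric] finite_PiE) auto
  also have "\<dots> = expect (map_pmf (\<lambda>V. \<Union>w<m. clique (V w)) ?M) (\<lambda>E. of_bool (E \<in> A))"
    by simp
  finally show ?thesis unfolding map_Pi_pmf_union .
qed

section \<open>Tail of the number of choosers of an object\<close>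

lemma binomial_le_power: "real (n choose k) \<le> real n ^ k"
proof -
  have "(n choose k) * 1 \<le> (n choose k) * fact k" by (intro mult_le_mono2) simp
  also have "\<dots> \<le> n ^ k" by (rule binomial_fact_pow)
  finally show ?thesis by (metis mult.right_neutral of_nat_le_iff of_nat_power)
qed

text \<open>Union bound over the \<open>k\<close>-element sets contained in the random
  subset.\<close>

lemma prob_card_ge_random_subset:
  assumes "0 < p" "p \<le> 1"
  shows "expect (random_subset {..<n::nat} (\<lambda>_. p)) (\<lambda>V. of_bool (k \<le> card V)) \<le> real n ^ k * p ^ k"
proof -
  let ?\<mu> = "random_subset {..<n} (\<lambda>_. p)" and ?B = "{S. S \<subseteq> {..<n} \<and> card S = k}"
  have fin: "finite ?B" by simp
  have "expect ?\<mu> (\<lambda>V. of_bool (k \<le> card V)) \<le> expect ?\<mu> (\<lambda>V. \<Sum>S\<in>?B. of_bool (S \<subseteq> V))"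
  proof (rule expect_mono)
    fix V assume "V \<in> set_pmf ?\<mu>"
    then have V: "V \<subseteq> {..<n}" using set_random_subset by blast
    show "of_bool (k \<le> card V) \<le> (\<Sum>S\<in>?B. of_bool (S \<subseteq> V) :: real)"
    proof (cases "k \<le> card V")
      case True
      then obtain S where S: "S \<subseteq> V" "card S = k" using obtain_subset_with_card_n by metis
      then have "of_bool (S \<subseteq> V) \<le> (\<Sum>S\<in>?B. of_bool (S \<subseteq> V) :: real)"
        using V fin by (intro member_le_sum) auto
      then show ?thesis using S by simp
    qed (simp add: sum_nonneg)
  qed simp
  also have "\<dots> = (\<Sum>S\<in>?B. p ^ k)"
    using assms by (subst expect_sum) (auto simp: prob_superset_random_subset intro!: sum.cong)
  also have "\<dots> = real (n choose k) * p ^ k"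
    by (simp add: n_subsets)
  also have "\<dots> \<le> real n ^ k * p ^ k"
    using assms by (intro mult_right_mono binomial_le_power) auto
  finally show ?thesis .
qed

section \<open>Adding random triangles to a binomial random graph\<close>

text \<open>The likelihood ratio $L$ of the union with respect to the plain random subset satisfies
  $E(L^2) = E\,q^{-|h \cap h'|}$ with $h$, $h'$ independent, and by the Cauchy--Schwarz inequality
  the distance is at most the square root of $E(L^2) - 1$.\<close>

lemma tv_within_union_random_subset:
  assumes fin: "finite X" and H: "set_pmf H \<subseteq> Pow X" and q: "0 < q" "q \<le> 1"
    and overlap: "\<And>h. h \<in> set_pmf H \<Longrightarrow> expect H (\<lambda>h'. (1 / q) ^ card (h \<inter> h')) \<le> 1 + \<eta>"
  shows "tv_within (H \<bind> (\<lambda>h. map_pmf (\<lambda>Y. h \<union> Y) (random_subset X (\<lambda>_. q))))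
    (random_subset X (\<lambda>_. q)) (sqrt \<eta>)"
proof (rule tv_withinI)
  let ?Q = "random_subset X (\<lambda>_. q)"
  have finH: "finite (set_pmf H)" using H fin finite_subset by blast
  then show "finite (set_pmf (H \<bind> (\<lambda>h. map_pmf (\<lambda>Y. h \<union> Y) ?Q)))" "finite (set_pmf ?Q)"
    using fin by auto
  \<comment> \<open>\<open>w h\<close> is the density of the law of \<open>h \<union> Y\<close> with
    respect to \<open>?Q\<close>. Its average \<open>L\<close> over \<open>h\<close> is the
    likelihood ratio of the mixture.\<close>
  define w where "w = (\<lambda>h Y :: 'a set. if h \<subseteq> Y then (1 / q) ^ card h else 0 :: real)"
  define L where "L = (\<lambda>Y. expect H (\<lambda>h. w h Y))"
  have shift: "expect ?Q (\<lambda>Y. g (h \<union> Y)) = expect ?Q (\<lambda>Y. w h Y * g Y)"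
    if "h \<in> set_pmf H" for h and g :: "'a set \<Rightarrow> real"
    using expect_random_subset_superset[OF fin _ q, of h g] that H
    by (auto simp: w_def Un_commute)
  have mix: "expect H (\<lambda>h. expect ?Q (\<lambda>Y. g (h \<union> Y))) = expect ?Q (\<lambda>Y. L Y * g Y)" for g
  proof -
    have "expect H (\<lambda>h. expect ?Q (\<lambda>Y. g (h \<union> Y))) = expect H (\<lambda>h. expect ?Q (\<lambda>Y. w h Y * g Y))"
      by (rule expect_cong, rule shift)
    also have "\<dots> = expect ?Q (\<lambda>Y. L Y * g Y)"
      using finH fin by (subst expect_swap) (auto simp: L_def)
    finally show ?thesis .
  qed
  have L1: "expect ?Q L = 1" using mix[of "\<lambda>_. 1"] by simp
  \<comment> \<open>The product of the two densities lives on the supersets of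
    \<open>h \<union> h'\<close>. By inclusion-exclusion for cardinalities all but the overlap
    cancels.\<close>
  have ww: "expect ?Q (\<lambda>Y. w h Y * w h' Y) = (1 / q) ^ card (h \<inter> h')"
    if "h \<in> set_pmf H" "h' \<in> set_pmf H" for h h'
  proof -
    have h: "h \<subseteq> X" "h' \<subseteq> X" using that H by auto
    then have "finite h" "finite h'" using fin finite_subset by auto
    then have card: "card h + card h' = card (h \<union> h') + card (h \<inter> h')" by (rule card_Un_Int)
    have "expect ?Q (\<lambda>Y. w h Y * w h' Y)
        = expect ?Q (\<lambda>Y. (1 / q) ^ (card h + card h') * of_bool (h \<union> h' \<subseteq> Y))"
      by (rule expect_cong) (auto simp: w_def power_add)
    also have "\<dots> = (1 / q) ^ (card h + card h') * q ^ card (h \<union> h')"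
      using h q prob_superset_random_subset[OF fin, of "h \<union> h'" q] by simp
    also have "\<dots> = (1 / q) ^ card (h \<inter> h')"
      using q by (simp add: card power_add power_one_over)
    finally show ?thesis .
  qed
  \<comment> \<open>Using \<open>L\<close> itself as the function in \<open>mix\<close> gives the
    second moment, which then unfolds into two independent copies of \<open>H\<close>.\<close>
  have "expect ?Q (\<lambda>Y. L Y * L Y) = expect H (\<lambda>h. expect ?Q (\<lambda>Y. L (h \<union> Y)))"
    using mix[of L] by simp
  also have "\<dots> = expect H (\<lambda>h. expect ?Q (\<lambda>Y. w h Y * L Y))"
    by (rule expect_cong, rule shift)
  also have "\<dots> = expect H (\<lambda>h. expect H (\<lambda>h'. expect ?Q (\<lambda>Y. w h Y * w h' Y)))"
    using finH fin by (subst (2) expect_swap) (auto simp: L_def)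
  also have "\<dots> = expect H (\<lambda>h. expect H (\<lambda>h'. (1 / q) ^ card (h \<inter> h')))"
    by (intro expect_cong ww)
  also have "\<dots> \<le> expect H (\<lambda>_. 1 + \<eta>)"
    by (rule expect_mono[OF finH overlap])
  finally have L2: "expect ?Q (\<lambda>Y. L Y * L Y) \<le> 1 + \<eta>" by simp
  let ?g = "\<lambda>Y. \<bar>L Y - 1\<bar>" let ?c = "expect ?Q ?g"
  have g2: "expect ?Q (\<lambda>Y. (?g Y)\<^sup>2) \<le> \<eta>"
  proof -
    have "expect ?Q (\<lambda>Y. (?g Y)\<^sup>2) = expect ?Q (\<lambda>Y. (L Y * L Y + 1) - 2 * L Y)"
      by (rule expect_cong) (simp add: power2_eq_square algebra_simps)
    also have "\<dots> = expect ?Q (\<lambda>Y. L Y * L Y) - 1"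
      using fin by (simp add: expect_diff expect_add L1)
    finally show ?thesis using L2 by simp
  qed
  \<comment> \<open>Nonnegativity of the variance of \<open>?g\<close> bounds its mean by the root
    of its second moment.\<close>
  have "0 \<le> expect ?Q (\<lambda>Y. (?g Y - ?c)\<^sup>2)"
    by (rule Bochner_Integration.integral_nonneg) simp
  also have "\<dots> = expect ?Q (\<lambda>Y. ((?g Y)\<^sup>2 + ?c\<^sup>2) - 2 * ?c * ?g Y)"
    by (rule expect_cong) (simp only: power2_diff algebra_simps)
  also have "\<dots> = expect ?Q (\<lambda>Y. (?g Y)\<^sup>2) - ?c\<^sup>2"
    using fin by (simp add: expect_diff expect_add power2_eq_square)
  finally have "?c\<^sup>2 \<le> \<eta>" using g2 by simp
  then have c: "?c \<le> sqrt \<eta>" by (rule real_le_rsqrt)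
  fix f :: "'a set \<Rightarrow> real" assume f: "\<And>x. 0 \<le> f x" "\<And>x. f x \<le> 1"
  have "expect (H \<bind> (\<lambda>h. map_pmf (\<lambda>Y. h \<union> Y) ?Q)) f = expect ?Q (\<lambda>Y. L Y * f Y)"
    using finH fin by (subst expect_bind) (auto simp: mix)
  also have "\<dots> \<le> expect ?Q (\<lambda>Y. f Y + ?g Y)"
  proof (rule expect_mono)
    fix Y
    have "(L Y - 1) * f Y \<le> ?g Y * 1"
      using f[of Y] by (intro mult_mono) auto
    then show "L Y * f Y \<le> f Y + ?g Y" by (simp add: algebra_simps)
  qed (use fin in auto)
  also have "\<dots> = expect ?Q f + ?c"
    using fin by (simp add: expect_add)
  finally show "expect (H \<bind> (\<lambda>h. map_pmf (\<lambda>Y. h \<union> Y) ?Q)) f \<le> expect ?Q f + sqrt \<eta>"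
    using c by simp
qed

section \<open>Overlaps of random triangles with a fixed edge set\<close>

lemma clique_altdef: "clique V = {e. e \<subseteq> V \<and> card e = 2}"
  unfolding clique_def card_2_iff by auto

lemma card_clique_le:
  assumes "finite V"
  shows "finite (clique V)" "card (clique V) = card V choose 2"
proof -
  show "finite (clique V)" using assms unfolding clique_altdef by simp
  show "card (clique V) = card V choose 2" using assms unfolding clique_altdef by (rule n_subsets)
qed

definition vsets :: "nat \<Rightarrow> nat \<Rightarrow> nat set set" where
  "vsets n k = {T. T \<subseteq> {..<n} \<and> card T = k}"

lemma finite_vsets [simp]: "finite (vsets n k)"
  by (simp add: vsets_def)

lemma card_vsets: "card (vsets n k) = n choose k"
  by (simp add: vsets_def n_subsets)

lemma all_edges_eq: "all_edges n = vsets n 2"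
  unfolding all_edges_def vsets_def card_2_iff by auto

text \<open>A triangle with an edge in \<open>h\<close> is that edge plus a vertex, which leaves at
  most \<open>n * card h\<close> choices. A triangle with two edges in \<open>h\<close> is the union
  of these edges, so there are at most \<open>card h ^ 2\<close>. Overlap one contributes at most
  \<open>x\<close>, larger overlaps at most \<open>x ^ 3\<close>.\<close>

lemma sum_overlap_triangles:
  fixes x :: real
  assumes h: "h \<subseteq> all_edges n" and x: "1 \<le> x"
  shows "(\<Sum>T\<in>vsets n 3. x ^ card (h \<inter> clique T) - 1) \<le> x * real n * real (card h) + x ^ 3 * real (card h) ^ 2"
proof -
  have fin: "finite h" by (rule finite_subset[OF h finite_all_edges])
  have T: "finite T" "finite (clique T)" "card (clique T) = 3" if "T \<in> vsets n 3" for T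
  proof -
    show "finite T" using that finite_subset unfolding vsets_def by auto
    then show "finite (clique T)" "card (clique T) = 3"
      using that card_clique_le[of T] by (auto simp: vsets_def numeral_3_eq_3 numeral_2_eq_2)
  qed
  define B where "B = (\<lambda>k. {T \<in> vsets n 3. k \<le> card (h \<inter> clique T)})"
  have B1: "card (B 1) \<le> n * card h"
  proof -
    have "B 1 \<subseteq> (\<lambda>(e, v). insert v e) ` (h \<times> {..<n})"
    proof
      fix T assume TB: "T \<in> B 1"
      then have "h \<inter> clique T \<noteq> {}" and T3: "T \<in> vsets n 3" by (auto simp: B_def)
      then obtain e where e: "e \<in> h" "e \<subseteq> T" "card e = 2" by (auto simp: clique_altdef)
      have "card (T - e) = 1"
        using T(1)[OF T3] T3 e by (subst card_Diff_subset) (auto simp: vsets_def finite_subset)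
      then obtain v where v: "T - e = {v}" by (rule card_1_singletonE)
      then have "T = insert v e" "v < n" using e T3 by (auto simp: vsets_def)
      then show "T \<in> (\<lambda>(e, v). insert v e) ` (h \<times> {..<n})" using e by auto
    qed
    then have "card (B 1) \<le> card (h \<times> {..<n})" using fin by (intro surj_card_le) auto
    then show ?thesis by (simp add: card_cartesian_product mult.commute)
  qed
  have B2: "card (B 2) \<le> card h ^ 2"
  proof -
    have "B 2 \<subseteq> (\<lambda>(e, e'). e \<union> e') ` (h \<times> h)"
    proof
      fix T assume TB: "T \<in> B 2"
      then have T3: "T \<in> vsets n 3" and c: "2 \<le> card (h \<inter> clique T)" by (auto simp: B_def)
      obtain S where "S \<subseteq> h \<inter> clique T" "card S = 2" using c obtain_subset_with_card_n by metis
      moreover from this(2) obtain e e' where "S = {e, e'}" "e \<noteq> e'" unfolding card_2_iff by blast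
      ultimately have e: "e \<in> h" "e' \<in> h" "e \<in> clique T" "e' \<in> clique T" "e \<noteq> e'" by auto
      have sub: "e \<union> e' \<subseteq> T" "card e = 2" "card e' = 2" using e by (auto simp: clique_altdef)
      have fe: "finite (e \<union> e')" using sub(1) T(1)[OF T3] finite_subset by blast
      \<comment> \<open>Two distinct pairs span at least three vertices, and these must be all of
        \<open>T\<close>.\<close>
      have "e \<subset> e \<union> e'" using e(5) sub fe card_subset_eq[of e e'] card_subset_eq[of e' e] by auto
      then have "card e < card (e \<union> e')" by (rule psubset_card_mono[OF fe])
      then have "e \<union> e' = T" using sub T(1)[OF T3] T3 by (intro card_seteq) (auto simp: vsets_def)
      then show "T \<in> (\<lambda>(e, e'). e \<union> e') ` (h \<times> h)" using e by auto
    qed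
    then have "card (B 2) \<le> card (h \<times> h)" using fin by (intro surj_card_le) auto
    then show ?thesis by (simp add: power2_eq_square card_cartesian_product)
  qed
  have "(\<Sum>T\<in>vsets n 3. x ^ card (h \<inter> clique T) - 1)
      \<le> (\<Sum>T\<in>vsets n 3. x * of_bool (T \<in> B 1) + x ^ 3 * of_bool (T \<in> B 2))"
  proof (rule sum_mono)
    fix T assume T3: "T \<in> vsets n 3"
    let ?a = "card (h \<inter> clique T)"
    have "?a \<le> 3" using card_mono[OF T(2)[OF T3], of "h \<inter> clique T"] T(3)[OF T3] by auto
    consider "?a = 0" | "?a = 1" | "2 \<le> ?a" by linarith
    then show "x ^ ?a - 1 \<le> x * of_bool (T \<in> B 1) + x ^ 3 * of_bool (T \<in> B 2)"
    proof cases
      case 3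
      have "x ^ ?a \<le> x ^ 3" using x \<open>?a \<le> 3\<close> by (intro power_increasing) auto
      then show ?thesis using 3 T3 x by (auto simp: B_def)
    qed (use T3 x in \<open>auto simp: B_def\<close>)
  qed
  also have "\<dots> = x * real (card (B 1)) + x ^ 3 * real (card (B 2))"
  proof -
    have "vsets n 3 \<inter> B k = B k" for k by (auto simp: B_def)
    then show ?thesis by (simp add: sum.distrib flip: sum_distrib_left)
  qed
  also have "\<dots> \<le> x * real (n * card h) + x ^ 3 * real (card h ^ 2)"
    using x B1 B2 by (intro add_mono mult_left_mono) (auto simp del: of_nat_mult of_nat_power)
  finally show ?thesis by simp
qed

text \<open>Counting each triangle separately overestimates the overlap, and the resulting product
  over independent triangles has an explicit mean. Then \<open>1 + t \<le> exp t\<close> turns the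
  product into the exponential of a sum.\<close>

lemma expect_overlap_triangles:
  assumes h: "h \<subseteq> all_edges n" and x: "1 \<le> x" and q: "0 \<le> q" "q \<le> 1"
  shows "expect (random_subset (vsets n 3) (\<lambda>_. q)) (\<lambda>Y. x ^ card (h \<inter> \<Union>(clique ` Y)))
    \<le> exp (q * (x * real n * real (card h) + x ^ 3 * real (card h) ^ 2))"
proof -
  let ?Q = "random_subset (vsets n 3) (\<lambda>_. q)"
  let ?a = "\<lambda>T. card (h \<inter> clique T)"
  have "expect ?Q (\<lambda>Y. x ^ card (h \<inter> \<Union>(clique ` Y))) \<le> expect ?Q (\<lambda>Y. \<Prod>T\<in>Y. x ^ ?a T)"
  proof (rule expect_mono)
    fix Y assume "Y \<in> set_pmf ?Q"
    then have "Y \<subseteq> vsets n 3" using set_random_subset[of "vsets n 3"] by blast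
    then have "finite Y" by (rule finite_subset) simp
    then have "card (\<Union>T\<in>Y. h \<inter> clique T) \<le> (\<Sum>T\<in>Y. ?a T)" by (rule card_UN_le)
    then have "x ^ card (\<Union>T\<in>Y. h \<inter> clique T) \<le> x ^ (\<Sum>T\<in>Y. ?a T)"
      using x by (rule power_increasing)
    moreover have "h \<inter> \<Union>(clique ` Y) = (\<Union>T\<in>Y. h \<inter> clique T)" by blast
    ultimately show "x ^ card (h \<inter> \<Union>(clique ` Y)) \<le> (\<Prod>T\<in>Y. x ^ ?a T)" by (simp only: power_sum)
  qed simp
  also have "\<dots> = (\<Prod>T\<in>vsets n 3. 1 + q * (x ^ ?a T - 1))"
    using q by (intro expect_random_subset_prod) auto
  also have "\<dots> \<le> (\<Prod>T\<in>vsets n 3. exp (q * (x ^ ?a T - 1)))"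
  proof (intro prod_mono conjI exp_ge_add_one_self)
    show "0 \<le> 1 + q * (x ^ ?a T - 1)" for T
      using q x one_le_power[of x "?a T"] by (simp add: add_nonneg_nonneg)
  qed
  also have "\<dots> = exp (q * (\<Sum>T\<in>vsets n 3. x ^ ?a T - 1))"
    by (simp add: exp_sum sum_distrib_left)
  also have "\<dots> \<le> exp (q * (x * real n * real (card h) + x ^ 3 * real (card h) ^ 2))"
    using sum_overlap_triangles[OF h x] q by (simp add: mult_left_mono)
  finally show ?thesis .
qed

section \<open>Poissonization of a single object\<close>

text \<open>\<open>1 - exp (- w x)\<close> is the chance that a Poisson variable of mean
  \<open>w x\<close> is positive. The empty set has mass \<open>exp (- sum w X)\<close> and
  \<open>{x}\<close> at least \<open>w x\<close> times that. All other sets are dropped since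
  \<open>g\<close> is nonnegative, and \<open>exp (- s) \<ge> 1 - s\<close> gives the
  prefactor.\<close>

lemma expect_random_subset_ge_singletons:
  assumes fin: "finite X" and w: "\<And>x. x \<in> X \<Longrightarrow> 0 \<le> w x" and g: "\<And>Y. 0 \<le> g Y"
  shows "(1 - sum w X) * (g {} + (\<Sum>x\<in>X. w x * g {x}))
    \<le> expect (random_subset X (\<lambda>x. 1 - exp (- w x))) g"
proof -
  let ?P = "random_subset X (\<lambda>x. 1 - exp (- w x))"
  have pmf: "pmf ?P Y = (\<Prod>x\<in>X. if x \<in> Y then 1 - exp (- w x) else exp (- w x))" if "Y \<subseteq> X" for Y
    using w that by (subst pmf_random_subset[OF fin]) (auto intro!: prod.cong)
  have empty: "pmf ?P {} = exp (- sum w X)"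
    by (simp add: pmf exp_sum[OF fin] sum_negf[symmetric])
  have single: "exp (- sum w X) * w x \<le> pmf ?P {x}" if x: "x \<in> X" for x
  proof -
    have "pmf ?P {x} = (1 - exp (- w x)) * (\<Prod>y\<in>X - {x}. exp (- w y))"
      using x fin by (subst pmf) (auto simp: prod.remove[of X x] intro!: prod.cong)
    also have "(\<Prod>y\<in>X - {x}. exp (- w y)) = exp (- sum w X) * exp (w x)"
      using x fin by (simp add: exp_sum[symmetric] sum_negf sum.remove[of X x] flip: exp_add)
    also have "(1 - exp (- w x)) * (exp (- sum w X) * exp (w x)) = exp (- sum w X) * (exp (w x) - 1)"
      by (simp add: algebra_simps flip: exp_add)
    also have "exp (- sum w X) * w x \<le> \<dots>"
    proof (rule mult_left_mono)
      show "w x \<le> exp (w x) - 1" using exp_ge_add_one_self[of "w x"] by linarith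
    qed simp
    finally show ?thesis .
  qed
  let ?S = "(\<lambda>x. {x}) ` X"
  have "(1 - sum w X) * (g {} + (\<Sum>x\<in>X. w x * g {x})) \<le> exp (- sum w X) * (g {} + (\<Sum>x\<in>X. w x * g {x}))"
    using exp_ge_add_one_self[of "- sum w X"] w g
    by (intro mult_right_mono add_nonneg_nonneg sum_nonneg mult_nonneg_nonneg) auto
  also have "\<dots> = g {} * pmf ?P {} + (\<Sum>x\<in>X. g {x} * (exp (- sum w X) * w x))"
    by (simp add: empty algebra_simps sum_distrib_left)
  also have "\<dots> \<le> g {} * pmf ?P {} + (\<Sum>x\<in>X. g {x} * pmf ?P {x})"
    using g single by (intro add_mono sum_mono mult_left_mono) auto
  also have "\<dots> = (\<Sum>Y\<in>insert {} ?S. g Y * pmf ?P Y)"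
    using fin by (subst sum.insert) (auto simp: sum.reindex)
  also have "\<dots> \<le> (\<Sum>Y\<in>Pow X. g Y * pmf ?P Y)"
    using fin g by (intro sum_mono2) auto
  also have "\<dots> = expect ?P g"
    using fin set_random_subset by (intro integral_measure_pmf_real[symmetric]) auto
  finally show ?thesis .
qed

text \<open>At most one chooser yields no edge, and four or more choosers are given up at cost
  \<open>n ^ 4 * p ^ 4\<close>. In the Poisson version the empty family has mass at least
  \<open>1 - s\<close> and each \<open>{T}\<close> at least \<open>(1 - s) * pmf \<mu> T\<close>,
  where \<open>s\<close> is the total mass of \<open>X\<close>. The mismatch costs
  \<open>s * s\<close>.\<close>

lemma tv_within_single_object:
  fixes n :: nat and p :: real
  assumes p: "0 < p" "p \<le> 1"
  defines "\<mu> \<equiv> random_subset {..<n} (\<lambda>_. p)" and "X \<equiv> vsets n 2 \<union> vsets n 3"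
  shows "tv_within (map_pmf clique \<mu>)
    (map_pmf (\<lambda>Y. \<Union>(clique ` Y)) (random_subset X (\<lambda>T. 1 - exp (- pmf \<mu> T))))
    (real n ^ 4 * p ^ 4 + (\<Sum>T\<in>X. pmf \<mu> T)\<^sup>2)"
proof (rule tv_withinI)
  let ?P = "random_subset X (\<lambda>T. 1 - exp (- pmf \<mu> T))"
  have finX: "finite X" by (simp add: X_def)
  have fin\<mu>: "finite (set_pmf \<mu>)" by (simp add: \<mu>_def)
  show "finite (set_pmf (map_pmf clique \<mu>))"
    "finite (set_pmf (map_pmf (\<lambda>Y. \<Union>(clique ` Y)) ?P))"
    using finX fin\<mu> by auto
  fix f :: "nat set set \<Rightarrow> real" assume f: "\<And>x. 0 \<le> f x" "\<And>x. f x \<le> 1"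
  define s where "s = (\<Sum>T\<in>X. pmf \<mu> T)"
  define F where "F = (\<Sum>T\<in>X. pmf \<mu> T * f (clique T))"
  define b where "b = expect \<mu> (\<lambda>V. of_bool (4 \<le> card V))"
  define e where "e = expect \<mu> (\<lambda>V. of_bool (card V \<le> 1))"
  have b: "b \<le> real n ^ 4 * p ^ 4"
    unfolding b_def \<mu>_def by (rule prob_card_ge_random_subset[OF p])
  have point: "expect \<mu> (\<lambda>V. of_bool (V = T) * c) = pmf \<mu> T * c" for T c
    by (subst integral_measure_pmf_real[where A = "{T}"]) (auto split: if_splits)
  \<comment> \<open>Any function of the set of choosers splits according to whether its size is at
    most 1, in {2, 3}, or at least 4.\<close>
  have decomp: "g V = of_bool (card V \<le> 1) * g V + of_bool (4 \<le> card V) * g V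
      + (\<Sum>T\<in>X. of_bool (V = T) * g T)" if "V \<in> set_pmf \<mu>" for g :: "nat set \<Rightarrow> real" and V
  proof -
    have "V \<subseteq> {..<n}" using that set_random_subset[of "{..<n}"] unfolding \<mu>_def by blast
    then have "V \<in> X \<longleftrightarrow> card V = 2 \<or> card V = 3" by (auto simp: X_def vsets_def)
    moreover have "(\<Sum>T\<in>X. of_bool (V = T) * g T) = (if V \<in> X then g V else 0)"
      using finX by (simp add: of_bool_def if_distrib[of "\<lambda>x. x * _"] cong: if_cong)
    moreover consider "card V \<le> 1" | "card V = 2" | "card V = 3" | "4 \<le> card V" by linarith
    ultimately show ?thesis by cases auto
  qed
  have "1 = expect \<mu> (\<lambda>_. 1)" by simp
  also have "\<dots> = expect \<mu> (\<lambda>V. of_bool (card V \<le> 1) * 1 + of_bool (4 \<le> card V) * 1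
      + (\<Sum>T\<in>X. of_bool (V = T) * 1))"
    by (rule expect_cong) (rule decomp[of _ "\<lambda>_. 1"])
  also have "\<dots> = e + b + s"
    unfolding expect_add[OF fin\<mu>] expect_sum[OF fin\<mu>] point by (simp add: e_def b_def s_def)
  finally have "1 = e + b + s" .
  moreover have "0 \<le> b" unfolding b_def by (rule expect_bounds(1)[OF fin\<mu>]) auto
  ultimately have e: "e \<le> 1 - s" by linarith
  have "expect \<mu> (\<lambda>V. f (clique V)) = expect \<mu> (\<lambda>V. of_bool (card V \<le> 1) * f (clique V)
      + of_bool (4 \<le> card V) * f (clique V) + (\<Sum>T\<in>X. of_bool (V = T) * f (clique T)))"
    by (rule expect_cong) (rule decomp)
  also have "\<dots> \<le> expect \<mu> (\<lambda>V. of_bool (card V \<le> 1) * f {} + of_bool (4 \<le> card V)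
      + (\<Sum>T\<in>X. of_bool (V = T) * f (clique T)))"
  proof (rule expect_mono[OF fin\<mu>])
    fix V assume "V \<in> set_pmf \<mu>"
    then have "V \<subseteq> {..<n}" using set_random_subset[of "{..<n}"] unfolding \<mu>_def by blast
    then have finV: "finite V" by (rule finite_subset) simp
    have "clique V = {}" if "card V \<le> 1"
    proof -
      have "card e \<noteq> 2" if "e \<subseteq> V" for e
        using card_mono[OF finV that] \<open>card V \<le> 1\<close> by linarith
      then show ?thesis by (auto simp: clique_altdef)
    qed
    then show "of_bool (card V \<le> 1) * f (clique V) + of_bool (4 \<le> card V) * f (clique V)
        + (\<Sum>T\<in>X. of_bool (V = T) * f (clique T))
      \<le> of_bool (card V \<le> 1) * f {} + of_bool (4 \<le> card V) + (\<Sum>T\<in>X. of_bool (V = T) * f (clique T))"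
      using f by auto
  qed
  also have "\<dots> = e * f {} + b + F"
    unfolding expect_add[OF fin\<mu>] expect_sum[OF fin\<mu>] point by (simp add: e_def b_def F_def)
  also have "\<dots> \<le> (1 - s) * f {} + real n ^ 4 * p ^ 4 + F"
    using b e f by (intro add_mono mult_right_mono) auto
  \<comment> \<open>Completing to \<open>(1 - s) * (f {} + F)\<close>, the form bounded by the
    Poisson version, leaves the error \<open>s * F\<close>.\<close>
  also have "\<dots> = (1 - s) * (f {} + F) + s * F + real n ^ 4 * p ^ 4"
    by (simp add: algebra_simps)
  also have "(1 - s) * (f {} + F) \<le> expect ?P (\<lambda>Y. f (\<Union>(clique ` Y)))"
    using expect_random_subset_ge_singletons[OF finX, of "pmf \<mu>" "\<lambda>Y. f (\<Union>(clique ` Y))"] f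
    by (simp add: s_def F_def)
  also have "s * F \<le> s * s"
  proof (rule mult_left_mono)
    show "F \<le> s" unfolding F_def s_def
      using f by (intro sum_mono) (simp add: mult_left_le)
    show "0 \<le> s" unfolding s_def by (simp add: sum_nonneg)
  qed
  finally show "expect (map_pmf clique \<mu>) f
      \<le> expect (map_pmf (\<lambda>Y. \<Union>(clique ` Y)) ?P) f + (real n ^ 4 * p ^ 4 + (\<Sum>T\<in>X. pmf \<mu> T)\<^sup>2)"
    by (simp add: s_def power2_eq_square)
qed

text \<open>Markov's inequality for the number of triangles, whose mean is at most
  \<open>n ^ 3 * q\<close>. Replacing crowded outcomes by the empty set keeps the edge sets bounded
  for the second moment estimate.\<close>

lemma tv_within_truncated_triangles:
  fixes n :: nat and q K :: real and J :: "nat set set \<Rightarrow> 'a set"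
  assumes q: "0 < q" "q \<le> 1" and K: "0 < K"
  defines "P \<equiv> random_subset (vsets n 3) (\<lambda>_. q)"
  shows "tv_within (map_pmf J P) (map_pmf (\<lambda>Y. if real (card Y) \<le> K then J Y else {}) P)
    (real n ^ 3 * q / K)"
proof (rule tv_withinI)
  let ?J = "\<lambda>Y. if real (card Y) \<le> K then J Y else {}"
  have finP: "finite (set_pmf P)" by (simp add: P_def)
  then show "finite (set_pmf (map_pmf J P))" "finite (set_pmf (map_pmf ?J P))" by auto
  have "expect P (\<lambda>Y. real (card Y)) = expect P (\<lambda>Y. \<Sum>T\<in>vsets n 3. of_bool ({T} \<subseteq> Y))"
  proof (rule expect_cong)
    fix Y assume "Y \<in> set_pmf P"
    then have "vsets n 3 \<inter> Y = Y" using set_random_subset[of "vsets n 3"] unfolding P_def by blast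
    then show "real (card Y) = (\<Sum>T\<in>vsets n 3. of_bool ({T} \<subseteq> Y))" by simp
  qed
  also have "\<dots> = (\<Sum>T\<in>vsets n 3. q ^ card {T})"
    unfolding expect_sum[OF finP] unfolding P_def
    using q by (intro sum.cong prob_superset_random_subset) auto
  also have "\<dots> = real (n choose 3) * q" by (simp add: card_vsets)
  also have "\<dots> \<le> real n ^ 3 * q" using q by (intro mult_right_mono binomial_le_power) auto
  finally have E: "expect P (\<lambda>Y. real (card Y)) \<le> real n ^ 3 * q" .
  fix f :: "'a set \<Rightarrow> real" assume f: "\<And>x. 0 \<le> f x" "\<And>x. f x \<le> 1"
  have "expect P (\<lambda>Y. f (J Y)) \<le> expect P (\<lambda>Y. f (?J Y) + real (card Y) / K)"
  proof (rule expect_mono[OF finP])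
    fix Y
    show "f (J Y) \<le> f (?J Y) + real (card Y) / K"
    proof (cases "real (card Y) \<le> K")
      case False
      then have "1 \<le> real (card Y) / K" using K by simp
      then show ?thesis using False f(2)[of "J Y"] f(1)[of "{}"] by simp
    qed (use K in simp)
  qed
  also have "\<dots> = expect P (\<lambda>Y. f (?J Y)) + expect P (\<lambda>Y. real (card Y)) / K"
    by (simp add: expect_add[OF finP])
  also have "\<dots> \<le> expect P (\<lambda>Y. f (?J Y)) + real n ^ 3 * q / K"
    using E K by (intro add_left_mono divide_right_mono) auto
  finally show "expect (map_pmf J P) f \<le> expect (map_pmf ?J P) f + real n ^ 3 * q / K"
    by simp
qed

text \<open>Truncation at \<open>K\<close> triangles leaves at most \<open>3 * K\<close> edges, and
  this smaller family is absorbed by the second moment bound. The parameter \<open>x\<close> allows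
  a convenient upper bound in place of \<open>1 / q2\<close>.\<close>

lemma tv_within_edges_triangles:
  fixes K x :: real
  assumes q2: "0 < q2" "q2 \<le> 1" and q3: "0 < q3" "q3 \<le> 1" and K: "0 < K" and x: "1 / q2 \<le> x"
  shows "tv_within
    (map_pmf (\<lambda>Y. \<Union>(clique ` Y)) (random_subset (vsets n 3) (\<lambda>_. q3)) \<bind>
      (\<lambda>h. map_pmf (\<lambda>Y. h \<union> Y) (random_subset (all_edges n) (\<lambda>_. q2))))
    (random_subset (all_edges n) (\<lambda>_. q2))
    (real n ^ 3 * q3 / K + sqrt (exp (q3 * (x * real n * (3 * K) + x ^ 3 * (3 * K)\<^sup>2)) - 1))"
proof -
  let ?P = "random_subset (vsets n 3) (\<lambda>_. q3)" and ?Q = "random_subset (all_edges n) (\<lambda>_. q2)"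
  let ?J = "\<lambda>Y. \<Union>(clique ` Y)"
  let ?J' = "\<lambda>Y. if real (card Y) \<le> K then ?J Y else {}"
  define H where "H = map_pmf ?J' ?P"
  have J: "?J Y \<subseteq> all_edges n" "card (?J Y) \<le> 3 * card Y" if "Y \<subseteq> vsets n 3" for Y
  proof -
    show "?J Y \<subseteq> all_edges n"
      using that by (force simp: all_edges_eq vsets_def clique_altdef)
    have fin: "finite Y" by (rule finite_subset[OF that finite_vsets])
    have "card (?J Y) \<le> (\<Sum>T\<in>Y. card (clique T))" by (rule card_UN_le[OF fin])
    also have "\<dots> \<le> (\<Sum>T\<in>Y. 3)"
    proof (rule sum_mono)
      fix T assume "T \<in> Y"
      then have "T \<subseteq> {..<n}" "card T = 3" using that by (auto simp: vsets_def)
      then show "card (clique T) \<le> 3"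
        using card_clique_le[of T] finite_subset[of T "{..<n}"] by (simp add: numeral_3_eq_3 numeral_2_eq_2)
    qed
    finally show "card (?J Y) \<le> 3 * card Y" by simp
  qed
  have P: "Y \<subseteq> vsets n 3" if "Y \<in> set_pmf ?P" for Y
    using that set_random_subset[of "vsets n 3"] by blast
  have "h \<subseteq> all_edges n \<and> real (card h) \<le> 3 * K" if h: "h \<in> set_pmf H" for h
  proof -
    obtain Y where Y: "h = ?J' Y" "Y \<in> set_pmf ?P"
      using h unfolding H_def set_map_pmf by (rule imageE)
    then show ?thesis using J[OF P[OF Y(2)]] K by (auto split: if_splits)
  qed
  then have hH: "h \<subseteq> all_edges n" "real (card h) \<le> 3 * K" if "h \<in> set_pmf H" for h
    using that by auto
  have x1: "1 \<le> 1 / q2" using q2 by simp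
  have tri: "tv_within (map_pmf ?J ?P) H (real n ^ 3 * q3 / K)"
    unfolding H_def by (rule tv_within_truncated_triangles[OF q3 K])
  \<comment> \<open>Both sides add the same independent edges, hence the second summand 0.\<close>
  have 1: "tv_within (map_pmf ?J ?P \<bind> (\<lambda>h. map_pmf (\<lambda>Y. h \<union> Y) ?Q))
      (H \<bind> (\<lambda>h. map_pmf (\<lambda>Y. h \<union> Y) ?Q)) (real n ^ 3 * q3 / K + 0)"
    by (rule tv_within_bind[OF _ _ _ _ tri]) (auto simp: H_def tv_within_def)
  have 2: "tv_within (H \<bind> (\<lambda>h. map_pmf (\<lambda>Y. h \<union> Y) ?Q)) ?Q
     (sqrt (exp (q3 * (x * real n * (3 * K) + x ^ 3 * (3 * K)\<^sup>2)) - 1))"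
  proof (rule tv_within_union_random_subset[OF _ _ q2])
    show "set_pmf H \<subseteq> Pow (all_edges n)" using hH by auto
    fix h assume h: "h \<in> set_pmf H"
    \<comment> \<open>Undoing the truncation of the second copy only raises the integrand, because
      \<open>1 / q2 \<ge> 1\<close>. The bound on \<open>card h\<close> comes from the first
      copy.\<close>
    have "expect H (\<lambda>h'. (1 / q2) ^ card (h \<inter> h')) \<le> expect ?P (\<lambda>Y. (1 / q2) ^ card (h \<inter> ?J Y))"
      unfolding H_def integral_map_pmf
      using one_le_power[OF x1] by (intro expect_mono) auto
    also have "\<dots> \<le> exp (q3 * (1 / q2 * real n * real (card h) + (1 / q2) ^ 3 * real (card h) ^ 2))"
      using q3 by (intro expect_overlap_triangles[OF hH(1)[OF h] x1]) auto
    also have "\<dots> \<le> exp (q3 * (x * real n * (3 * K) + x ^ 3 * (3 * K)\<^sup>2))"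
    proof -
      have x0: "0 \<le> x" using x x1 by linarith
      have "1 / q2 * real n * real (card h) \<le> x * real n * (3 * K)"
        using q2 hH(2)[OF h] by (intro mult_mono x) (auto simp: x0)
      moreover have "(1 / q2) ^ 3 * real (card h) ^ 2 \<le> x ^ 3 * (3 * K)\<^sup>2"
        using q2 hH(2)[OF h] by (intro mult_mono power_mono x) (auto simp: x0)
      ultimately show ?thesis using q3 by (simp only: exp_le_cancel_iff mult_left_mono add_mono)
    qed
    finally show "expect H (\<lambda>h'. (1 / q2) ^ card (h \<inter> h'))
      \<le> 1 + (exp (q3 * (x * real n * (3 * K) + x ^ 3 * (3 * K)\<^sup>2)) - 1)" by simp
  qed simp
  show ?thesis using tv_within_trans[OF 1 2] by simp
qed

section \<open>Comparison of the two graph models\<close>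

lemma one_minus_power_ge: "0 \<le> p \<Longrightarrow> p \<le> 1 \<Longrightarrow> 1 - real n * p \<le> (1 - p) ^ n"
  using Bernoulli_inequality[of "- p" n] by simp

text \<open>Replacing the objects one by one costs \<open>m * d\<close>. The Poisson family then
  splits exactly into independent edges of probability p_- and independent triangles, which are
  absorbed at the cost of a Markov term and a second moment term. The three costs are bounded in
  terms of \<open>\<tau>\<close> separately.\<close>

lemma prob_RIG_minus_prob_Gnp_le:
  fixes n m :: nat and p \<tau> :: real
  defines "\<tau> \<equiv> real n ^ 2 * p * (1 + real m * p\<^sup>2)"
  assumes n: "1 \<le> n" and m: "1 \<le> m" and p: "0 < p" and small: "\<tau> \<le> 1 / 2"
  shows "\<bar>prob_RIG n m p A - prob_Gnp n (1 - exp (- real m * p ^ 2 * (1 - p) ^ (n - 2))) A\<bar>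
    \<le> 5 * \<tau>\<^sup>2 + \<tau> + sqrt (exp (78 * \<tau>) - 1)"
proof -
  \<comment> \<open>\<open>y\<close> is the mean number of objects shared by two given
    vertices.\<close>
  define y where "y = real m * p\<^sup>2"
  have y: "0 < y" using m p by (simp add: y_def)
  have n2p: "real n ^ 2 * p \<le> \<tau>" using y p by (simp add: \<tau>_def y_def[symmetric] algebra_simps)
  have "real n * p \<le> real n ^ 2 * p"
    using n p by (intro mult_right_mono) (auto simp: power2_eq_square)
  then have np: "real n * p \<le> 1 / 2" using n2p small by simp
  have "p \<le> real n * p" using n p by simp
  then have p1: "p < 1" using np by simp
  define \<mu> where "\<mu> = random_subset {..<n} (\<lambda>_. p)"
  define X where "X = vsets n 2 \<union> vsets n 3"
  have finX: "finite X" by (simp add: X_def)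
  \<comment> \<open>The probability that a given \<open>k\<close>-set is exactly the set of choosers
    of one object.\<close>
  define \<pi> where "\<pi> = (\<lambda>k. p ^ k * (1 - p) ^ (n - k))"
  have \<mu>: "pmf \<mu> T = \<pi> k" if "T \<in> vsets n k" for T k
    using that p p1 by (auto simp: \<mu>_def \<pi>_def vsets_def pmf_random_subset_const)
  have \<pi>: "0 < \<pi> k" "\<pi> k \<le> p ^ k" for k
    using p p1 by (auto simp: \<pi>_def mult_left_le power_le_one)
  have disj: "vsets n 3 \<inter> vsets n 2 = {}" by (auto simp: vsets_def)
  have sum_k: "(\<Sum>T\<in>vsets n k. pmf \<mu> T) \<le> (real n * p) ^ k" for k
  proof -
    have "(\<Sum>T\<in>vsets n k. pmf \<mu> T) = real (n choose k) * \<pi> k"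
      by (simp add: \<mu> card_vsets)
    also have "\<dots> \<le> real n ^ k * p ^ k"
      using \<pi>[of k] by (intro mult_mono binomial_le_power) auto
    finally show ?thesis by (simp add: power_mult_distrib)
  qed
  have "(\<Sum>T\<in>X. pmf \<mu> T) = (\<Sum>T\<in>vsets n 2. pmf \<mu> T) + (\<Sum>T\<in>vsets n 3. pmf \<mu> T)"
    unfolding X_def using disj by (intro sum.union_disjoint) auto
  also have "\<dots> \<le> (real n * p)\<^sup>2 + (real n * p) ^ 3"
    by (intro add_mono sum_k)
  also have "\<dots> \<le> 2 * (real n * p)\<^sup>2"
    using power_decreasing[of 2 3 "real n * p"] np p by simp
  finally have s: "(\<Sum>T\<in>X. pmf \<mu> T) \<le> 2 * (real n * p)\<^sup>2" .
  define r where "r = (\<lambda>T. 1 - exp (- pmf \<mu> T))"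
  \<comment> \<open>The probability that a given \<open>k\<close>-set occurs when the number of
    objects with exactly these choosers is Poisson of mean \<open>m * \<pi> k\<close>. For
    \<open>k = 2\<close> it is p_-.\<close>
  define q where "q = (\<lambda>k. 1 - exp (- real m * \<pi> k))"
  have q: "0 < q k" "q k \<le> 1" "q k \<le> real m * \<pi> k" for k
    using m \<pi>[of k] exp_ge_add_one_self[of "- real m * \<pi> k"] by (auto simp: q_def)
  let ?J = "\<lambda>Y. \<Union>(clique ` Y)"
  have r01: "0 \<le> r T \<and> r T \<le> 1" for T by (simp add: r_def)
  have qr: "1 - (1 - r T) ^ m = q k" if "T \<in> vsets n k" for T k
    using \<mu>[OF that] by (simp add: r_def q_def flip: exp_of_nat_mult)
  define d where "d = real n ^ 4 * p ^ 4 + (\<Sum>T\<in>X. pmf \<mu> T)\<^sup>2"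
  have step1: "tv_within (union_pow (map_pmf clique \<mu>) m) (union_pow (map_pmf ?J (random_subset X r)) m)
      (real m * d)"
    unfolding d_def r_def \<mu>_def X_def
    using p p1 by (intro tv_within_union_pow tv_within_single_object) auto
  have J_id: "?J Y = Y" if "Y \<subseteq> vsets n 2" for Y
  proof -
    have "clique T = {T}" if "T \<in> Y" for T
    proof -
      have T: "T \<subseteq> {..<n}" "card T = 2" using that \<open>Y \<subseteq> vsets n 2\<close> by (auto simp: vsets_def)
      then have "finite T" using finite_subset by blast
      then have "e = T" if "e \<subseteq> T" "card e = 2" for e
        using that T card_subset_eq[of T e] by auto
      then show ?thesis using T by (auto simp: clique_altdef)
    qed
    then show ?thesis by auto
  qed
  have "union_pow (map_pmf ?J (random_subset X r)) m = map_pmf ?J (union_pow (random_subset X r) m)"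
    by (rule union_pow_map) auto
  also have "union_pow (random_subset X r) m = random_subset X (\<lambda>T. 1 - (1 - r T) ^ m)"
    using finX r01 by (rule union_pow_random_subset)
  \<comment> \<open>Pairs and triples are disjoint index sets, so the Poisson family splits into
    independent parts. By \<open>J_id\<close> the pairs pass through \<open>?J\<close>
    unchanged.\<close>
  also have "\<dots> = random_subset (vsets n 3) (\<lambda>_. q 3) \<bind>
      (\<lambda>Y. map_pmf (\<lambda>Z. Y \<union> Z) (random_subset (vsets n 2) (\<lambda>_. q 2)))"
  proof -
    have "X = vsets n 3 \<union> vsets n 2" by (auto simp: X_def)
    moreover have "random_subset (vsets n k) (\<lambda>T. 1 - (1 - r T) ^ m) = random_subset (vsets n k) (\<lambda>_. q k)" for k
      by (intro random_subset_cong) (auto simp: qr)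
    ultimately show ?thesis by (simp add: random_subset_Un disj)
  qed
  also have "map_pmf ?J \<dots> = map_pmf ?J (random_subset (vsets n 3) (\<lambda>_. q 3)) \<bind>
      (\<lambda>h. map_pmf (\<lambda>Y. h \<union> Y) (random_subset (all_edges n) (\<lambda>_. q 2)))"
    unfolding map_bind_pmf bind_map_pmf map_pmf_comp all_edges_eq
  proof (intro bind_pmf_cong map_pmf_cong refl)
    fix Y Z assume "Z \<in> set_pmf (random_subset (vsets n 2) (\<lambda>_. q 2))"
    then have "Z \<subseteq> vsets n 2" using set_random_subset[of "vsets n 2"] by blast
    then show "?J (Y \<union> Z) = ?J Y \<union> Z" using J_id[of Z] by (simp add: image_Un)
  qed
  finally have mixture: "union_pow (map_pmf ?J (random_subset X r)) m = \<dots>" .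
  \<comment> \<open>This truncation level is $n^3 m p^3 / \tau$: it balances the Markov bound against the second moment.\<close>
  define K where "K = real n * y / (1 + y)"
  \<comment> \<open>This is \<open>(1 + z) / z\<close> at \<open>z = y / 2\<close>. That quotient
    decreases in \<open>z\<close> and dominates \<open>1 / q 2\<close> when \<open>z\<close> is the
    exponent in \<open>q 2\<close>, which is at least \<open>y / 2\<close>.\<close>
  define x where "x = (2 + y) / y"
  have K: "0 < K" using n y by (simp add: K_def)
  have x: "1 / q 2 \<le> x"
  proof -
    define z where "z = real m * \<pi> 2"
    have z: "0 < z" using m \<pi>[of 2] by (simp add: z_def)
    have "real (n - 2) * p \<le> real n * p" using p by (intro mult_right_mono) auto
    then have "1 / 2 \<le> 1 - real (n - 2) * p" using np by linarith
    also have "\<dots> \<le> (1 - p) ^ (n - 2)" using p p1 by (intro one_minus_power_ge) auto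
    finally have "y * (1 / 2) \<le> y * (1 - p) ^ (n - 2)" using y by (intro mult_left_mono) auto
    then have yz: "y / 2 \<le> z" by (simp add: z_def y_def \<pi>_def mult.assoc)
    \<comment> \<open>The target \<open>z \<le> (1 + z) * (1 - exp (- z))\<close> is
      \<open>1 + z \<le> exp z\<close> in disguise. Multiplying by \<open>exp z\<close> removes the
      negative exponent.\<close>
    have "exp z * q 2 = exp z - 1" by (simp add: q_def z_def algebra_simps flip: exp_add)
    then have "exp z * ((1 + z) * q 2) = (1 + z) * (exp z - 1)"
      by (simp only: mult.left_commute[of "exp z"])
    also have "\<dots> = z * exp z + (exp z - (1 + z))" by (simp add: algebra_simps)
    also have "\<dots> \<ge> z * exp z" using exp_ge_add_one_self[of z] by linarith
    finally have "exp z * z \<le> exp z * ((1 + z) * q 2)" by (simp only: mult.commute)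
    then have zq: "z \<le> (1 + z) * q 2" by simp
    then have "1 / q 2 \<le> (1 + z) / z" using z q(1)[of 2] by (simp add: field_simps)
    also have "\<dots> \<le> x" using yz z y by (simp add: x_def field_simps)
    finally show ?thesis .
  qed
  define \<eta> where "\<eta> = q 3 * (x * real n * (3 * K) + x ^ 3 * (3 * K)\<^sup>2)"
  have step2: "tv_within (union_pow (map_pmf ?J (random_subset X r)) m)
      (random_subset (all_edges n) (\<lambda>_. q 2)) (real n ^ 3 * q 3 / K + sqrt (exp \<eta> - 1))"
    unfolding mixture \<eta>_def by (rule tv_within_edges_triangles[OF q(1,2) q(1,2) K x])
  have "\<bar>prob_RIG n m p A - prob_Gnp n (q 2) A\<bar>
    = \<bar>expect (union_pow (map_pmf clique \<mu>) m) (\<lambda>E. of_bool (E \<in> A))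
      - expect (random_subset (all_edges n) (\<lambda>_. q 2)) (\<lambda>E. of_bool (E \<in> A))\<bar>"
    using p p1 q(1,2)[of 2] by (simp only: prob_RIG_eq prob_Gnp_eq \<mu>_def less_imp_le)
  also have "\<dots> \<le> real m * d + (real n ^ 3 * q 3 / K + sqrt (exp \<eta> - 1))"
    by (rule tv_withinD[OF tv_within_trans[OF step1 step2]]) simp_all
  finally have main: "\<bar>prob_RIG n m p A - prob_Gnp n (q 2) A\<bar>
      \<le> real m * d + (real n ^ 3 * q 3 / K + sqrt (exp \<eta> - 1))" .
  have q3: "q 3 \<le> p * y"
  proof -
    have "q 3 \<le> real m * \<pi> 3" by (rule q)
    also have "\<dots> \<le> real m * p ^ 3" by (intro mult_left_mono \<pi>) auto
    finally show ?thesis by (simp add: y_def power3_eq_cube power2_eq_square mult_ac)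
  qed
  have \<tau>: "\<tau> = real n ^ 2 * p * (1 + y)" by (simp add: \<tau>_def y_def)
  \<comment> \<open>The constant is 1 + 4: four or more choosers contribute
    \<open>n ^ 4 * p ^ 4\<close>, and the squared mass of \<open>X\<close> at most four times that.
    The factor \<open>m\<close> then produces \<open>(n ^ 2 * p) ^ 2 * y\<close>.\<close>
  have b1: "real m * d \<le> 5 * \<tau>\<^sup>2"
  proof -
    have "(\<Sum>T\<in>X. pmf \<mu> T)\<^sup>2 \<le> (2 * (real n * p)\<^sup>2)\<^sup>2"
      using s by (intro power_mono sum_nonneg) auto
    then have "d \<le> 5 * (real n ^ 4 * p ^ 4)"
      by (simp add: d_def power_mult_distrib mult.commute flip: power_mult)
    then have "real m * d \<le> real m * (5 * (real n ^ 4 * p ^ 4))" by (intro mult_left_mono) auto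
    also have "\<dots> = 5 * ((real n ^ 2 * p)\<^sup>2 * y)"
      by (simp add: y_def power_mult_distrib power_add[symmetric] mult_ac eval_nat_numeral)
    also have "\<dots> \<le> 5 * ((real n ^ 2 * p)\<^sup>2 * (1 + y)\<^sup>2)"
    proof -
      have "y \<le> (1 + y)\<^sup>2" using y by (simp add: power2_eq_square algebra_simps)
      then show ?thesis by (intro mult_left_mono) auto
    qed
    finally show ?thesis by (simp add: \<tau> power_mult_distrib)
  qed
  \<comment> \<open>After \<open>q 3 \<le> p * y\<close>, the choice of \<open>K\<close> makes the
    Markov bound exactly \<open>\<tau>\<close>.\<close>
  have b2: "real n ^ 3 * q 3 / K \<le> \<tau>"
  proof -
    have "real n ^ 3 * q 3 / K \<le> real n ^ 3 * (p * y) / K"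
      using q3 K by (intro divide_right_mono mult_left_mono) auto
    also have "\<dots> = \<tau>"
      using n y by (simp add: K_def \<tau> field_simps power3_eq_cube power2_eq_square)
    finally show ?thesis .
  qed
  have b3: "\<eta> \<le> 78 * \<tau>"
  proof -
    have x0: "0 \<le> x" using y by (simp add: x_def)
    have "\<eta> \<le> (p * y) * (x * real n * (3 * K) + x ^ 3 * (3 * K)\<^sup>2)"
      unfolding \<eta>_def using q3 x0 K by (intro mult_right_mono add_nonneg_nonneg) auto
    \<comment> \<open>Both terms become \<open>n ^ 2 * p\<close> times a function of
      \<open>y\<close>. Since \<open>(2 + y) / (1 + y) \<le> 2\<close>, they are at most 6 and 72
      times \<open>\<tau>\<close>, whence 78.\<close>
    also have "\<dots> = 3 * (real n ^ 2 * p) * (y * ((2 + y) / (1 + y)))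
        + 9 * (real n ^ 2 * p) * ((1 + y) * ((2 + y) / (1 + y)) ^ 3)"
    proof -
      have "(p * y) * (u / y * k * (3 * (k * y / v)) + (u / y) ^ 3 * (3 * (k * y / v))\<^sup>2)
          = 3 * (k ^ 2 * p) * (y * (u / v)) + 9 * (k ^ 2 * p) * (v * (u / v) ^ 3)"
        if "v \<noteq> 0" for u v k
        using that y by (simp add: field_simps power2_eq_square power3_eq_cube)
      from this[of "1 + y" "2 + y" "real n"] show ?thesis
        using y by (simp add: x_def K_def)
    qed
    also have "\<dots> \<le> 3 * (real n ^ 2 * p) * ((1 + y) * 2) + 9 * (real n ^ 2 * p) * ((1 + y) * 2 ^ 3)"
    proof -
      have "(2 + y) / (1 + y) \<le> 2" "0 \<le> (2 + y) / (1 + y)" using y by (simp_all add: field_simps)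
      then show ?thesis
        using y p by (intro add_mono mult_left_mono mult_mono power_mono) auto
    qed
    also have "\<dots> = 78 * \<tau>" by (simp add: \<tau> algebra_simps)
    finally show ?thesis .
  qed
  have "sqrt (exp \<eta> - 1) \<le> sqrt (exp (78 * \<tau>) - 1)" using b3 by simp
  then have "\<bar>prob_RIG n m p A - prob_Gnp n (q 2) A\<bar> \<le> 5 * \<tau>\<^sup>2 + \<tau> + sqrt (exp (78 * \<tau>) - 1)"
    using main b1 b2 by linarith
  then show ?thesis by (simp add: q_def \<pi>_def mult.assoc)
qed

section \<open>Passage to the limit\<close>

theorem theorem3:
  fixes a \<alpha> :: real and A :: "nat \<Rightarrow> nat set set set"
    and m :: "nat \<Rightarrow> nat" and p :: "nat \<Rightarrow> real"
  assumes a: "0 \<le> a" "a \<le> 1"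
    and mono: "monotone_graph_property A"
    and alpha: "\<alpha> > 4"
    and m_def: "\<And>n. m n = nat \<lfloor>real n powr \<alpha>\<rfloor>"
    and p01: "\<And>n. 0 \<le> p n \<and> p n \<le> 1"
    and p_lower: "p \<in> \<Omega>(\<lambda>n. 1 / (real n * root 3 (real (m n))))"
    and p_upper: "p \<in> O(\<lambda>n. sqrt (ln (real n) / real (m n)))"
    and lim_minus: "(\<lambda>n. prob_Gnp n (1 - exp (- real (m n) * p n ^ 2 * (1 - p n) ^ (n - 2))) (A n))
                      \<longlonglongrightarrow> a"
    and lim_plus: "(\<lambda>n. prob_Gnp n (1 - exp (- real (m n) * p n ^ 2 * (1 - p n) ^ (n - 2))
                          + 10 * root 3 (real (m n) * p n ^ 3)) (A n)) \<longlonglongrightarrow> a"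
  shows "(\<lambda>n. prob_RIG n (m n) (p n) (A n)) \<longlonglongrightarrow> a"
proof -
  define \<tau> where "\<tau> = (\<lambda>n. real n ^ 2 * p n * (1 + real (m n) * (p n)\<^sup>2))"
  \<comment> \<open>Taking the floor loses at most a factor 2 because
    \<open>n powr \<alpha> \<ge> 1\<close>.\<close>
  have m_ge: "real n powr \<alpha> / 2 \<le> real (m n)" "1 \<le> m n" if "1 \<le> n" for n
  proof -
    have 1: "1 \<le> real n powr \<alpha>" using that alpha by (intro ge_one_powr_ge_zero) auto
    then have "(1 :: int) \<le> \<lfloor>real n powr \<alpha>\<rfloor>" by simp
    then show "1 \<le> m n" unfolding m_def by linarith
    have "real (m n) = of_int \<lfloor>real n powr \<alpha>\<rfloor>" using 1 by (simp add: m_def)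
    moreover have "1 \<le> real (m n)" using \<open>1 \<le> m n\<close> by simp
    moreover have "real n powr \<alpha> < of_int \<lfloor>real n powr \<alpha>\<rfloor> + 1" by linarith
    ultimately show "real n powr \<alpha> / 2 \<le> real (m n)" by linarith
  qed
  obtain C where C: "0 < C"
    "\<forall>\<^sub>F n in sequentially. norm (p n) \<le> C * norm (sqrt (ln (real n) / real (m n)))"
    using p_upper by (elim landau_o.bigE) auto
  \<comment> \<open>Up to logarithms, \<open>n ^ 2 * p n\<close> is at most of order
    \<open>n powr (2 - \<alpha> / 2)\<close>, which is \<open>n powr (- \<beta>)\<close> and decays
    because \<open>\<alpha> > 4\<close>.\<close>
  define \<beta> where "\<beta> = (\<alpha> - 4) / 2"
  have \<beta>: "0 < \<beta>" using alpha by (simp add: \<beta>_def)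
  \<comment> \<open>A majorant of \<open>\<tau>\<close>: the last factor bounds
    \<open>1 + m n * (p n) ^ 2\<close>, the others bound \<open>n ^ 2 * p n\<close>.\<close>
  define B where "B = (\<lambda>n. C * sqrt 2 * (sqrt (ln (real n)) * real n powr (- \<beta>) * (1 + C\<^sup>2 * ln (real n))))"
  have \<tau>_nonneg: "0 \<le> \<tau> n" for n using p01 by (simp add: \<tau>_def)
  have "\<forall>\<^sub>F n in sequentially. norm (\<tau> n) \<le> B n"
    using C(2) eventually_ge_at_top[of 1]
  proof eventually_elim
    case (elim n)
    have l: "0 \<le> ln (real n)" using elim by simp
    have p_le: "p n \<le> C * sqrt (ln (real n) / real (m n))"
      using elim l p01[of n] by simp
    have mp: "real (m n) * (p n)\<^sup>2 \<le> C\<^sup>2 * ln (real n)"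
    proof -
      have "(p n)\<^sup>2 \<le> (C * sqrt (ln (real n) / real (m n)))\<^sup>2"
        using p_le p01 by (intro power_mono) auto
      also have "\<dots> = C\<^sup>2 * ln (real n) / real (m n)"
        using l by (simp add: power_mult_distrib)
      finally show ?thesis using m_ge(2)[of n] elim by (simp add: field_simps)
    qed
    have "ln (real n) / real (m n) \<le> ln (real n) / (real n powr \<alpha> / 2)"
      using m_ge[of n] l elim by (intro divide_left_mono) auto
    then have "C * sqrt (ln (real n) / real (m n)) \<le> C * sqrt (ln (real n) / (real n powr \<alpha> / 2))"
      using C(1) by (intro mult_left_mono) auto
    then have "p n \<le> C * sqrt (ln (real n) / (real n powr \<alpha> / 2))" using p_le by simp
    then have "real n ^ 2 * p n \<le> real n ^ 2 * (C * sqrt (ln (real n) / (real n powr \<alpha> / 2)))"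
      by (intro mult_left_mono) auto
    also have "\<dots> = C * sqrt 2 * (sqrt (ln (real n)) * real n powr (- \<beta>))"
    proof -
      have "sqrt (real n powr \<alpha>) = real n powr (\<alpha> / 2)"
        by (simp add: powr_half_sqrt[symmetric] powr_powr)
      moreover have "real n powr (- \<beta>) = real n ^ 2 / real n powr (\<alpha> / 2)"
        using elim by (simp add: \<beta>_def diff_divide_distrib powr_diff powr_numeral)
      ultimately show ?thesis by (simp add: real_sqrt_divide real_sqrt_mult)
    qed
    finally have "real n ^ 2 * p n \<le> C * sqrt 2 * (sqrt (ln (real n)) * real n powr (- \<beta>))" .
    then have "\<tau> n \<le> C * sqrt 2 * (sqrt (ln (real n)) * real n powr (- \<beta>)) * (1 + C\<^sup>2 * ln (real n))"
      unfolding \<tau>_def using mp p01[of n]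
      by (intro mult_mono[OF _ add_left_mono]) (use C(1) l in auto)
    then have "\<tau> n \<le> B n" by (simp only: B_def mult.assoc)
    then show "norm (\<tau> n) \<le> B n" using \<tau>_nonneg[of n] by simp
  qed
  moreover have "B \<longlonglongrightarrow> 0"
    unfolding B_def using \<beta> C(1) by real_asymp
  ultimately have \<tau>_lim: "\<tau> \<longlonglongrightarrow> 0"
    by (rule Lim_null_comparison)
  \<comment> \<open>The lower bound on \<open>p\<close> makes \<open>p n\<close> positive for all
    large \<open>n\<close>, as the comparison of the two models assumes.\<close>
  obtain c where c: "0 < c"
    "\<forall>\<^sub>F n in sequentially. norm (p n) \<ge> c * norm (1 / (real n * root 3 (real (m n))))"
    using p_lower by (elim landau_omega.bigE) auto
  let ?D = "\<lambda>n. prob_RIG n (m n) (p n) (A n)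
    - prob_Gnp n (1 - exp (- real (m n) * p n ^ 2 * (1 - p n) ^ (n - 2))) (A n)"
  have "\<forall>\<^sub>F n in sequentially. \<tau> n < 1 / 2"
    by (rule order_tendstoD(2)[OF \<tau>_lim]) simp
  then have bound: "\<forall>\<^sub>F n in sequentially. norm (?D n) \<le> 5 * (\<tau> n)\<^sup>2 + \<tau> n + sqrt (exp (78 * \<tau> n) - 1)"
    using c(2) eventually_ge_at_top[of 1]
  proof eventually_elim
    case (elim n)
    have "0 < 1 / (real n * root 3 (real (m n)))" using m_ge(2)[of n] elim by simp
    then have "0 < c * norm (1 / (real n * root 3 (real (m n))))" using c(1) by simp
    then have "0 < p n" using elim(2) p01[of n] by simp
    then show ?case
      using elim m_ge(2)[of n] prob_RIG_minus_prob_Gnp_le[of n "m n" "p n" "A n"] by (simp add: \<tau>_def)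
  qed
  \<comment> \<open>The error bound is continuous in \<open>\<tau>\<close> and vanishes at
    0.\<close>
  have "(\<lambda>n. 5 * (\<tau> n)\<^sup>2 + \<tau> n + sqrt (exp (78 * \<tau> n) - 1)) \<longlonglongrightarrow> 5 * 0\<^sup>2 + 0 + sqrt (exp (78 * 0) - 1)"
    by (intro tendsto_intros \<tau>_lim)
  then have "?D \<longlonglongrightarrow> 0"
    by (intro Lim_null_comparison[OF bound]) simp
  from tendsto_add[OF this lim_minus] show ?thesis by simp
qed

end
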